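(* For non-negative integers $n,m$, $$P_{x_{12}^nx_{23}^m}(\beta)=\sum_{k=0}^{\min(n,m)}\binom{n+m-k}{m}\binom mk\beta^k=\sum_{k=0}^{\min(n,m)}\binom nk\binom mk(1+\beta)^k.$$ Moreover: - the polynomial $P_{(x_{12}x_{23}\cdots x_{n-1,n})^m}(\beta-1)$ is a symmetric polynomial in $\beta$ with non-negative coefficients; - the polynomial $P_{x_{12}^nx_{23}^m}(\beta)$ counts the number of $(n,m)$-Delannoy paths according to the number of $NE$ steps, i.e. the coefficient of $\beta^k$ is the number of $(n,m)$-Delannoy paths with exactly $k$ $NE$ steps.
   Context: For a monomial $M$ in commuting variables $x_{ij}$, $i<j$, over $\mathbb{Z}[\beta]$, a reduced polynomial of $M$ is obtained by repeatedly replacing (in any monomial) a product $x_{ij}x_{jk}$, $i<j<k$, by $x_{ik}x_{ij}+x_{jk}x_{ik}+\beta x_{ik}$, until no monomial contains such a product. $P_M(\beta)$ denotes the value of the reduced polynomial at $x_{ij}=1$ for all $i<j$ (the replacements are applied successively starting from the leftmost variables $x_{12}^{m_1}x_{23}$). An $(n,m)$-Delannoy path is a lattice path from $(0,0)$ to $(n,m)$ with steps $E=(1,0)$, $N=(0,1)$, $NE=(1,1)$. A polynomial $\sum_{i=0}^{d}a_i\beta^i$ of degree $d$ is symmetric if $a_i=a_{d-i}$. *)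

theory Defs
  imports
    "HOL-Library.Poly_Mapping"
    "HOL-Library.Product_Plus"
    "HOL-Computational_Algebra.Polynomial_FPS"
    "HOL-Combinatorics.Permutations"
begin

section \<open>Reduced polynomials\<close>

text \<open>
  The variable $x_{ij}$ is represented by the pair \<open>(i, j)\<close>, a monomial by its exponent function,
  and $\mathbb{Z}[\beta]$ by \<open>int poly\<close>. So \<open>xpoly\<close> is the ring of polynomials in commuting
  variables over $\mathbb{Z}[\beta]$; its multiplication is the convolution product of
  \<open>Poly_Mapping\<close>. The variables $x_{ij}$ with $i \geq j$ exist in the type but are never rewritten
  nor created by rewriting.
\<close>

type_synonym xmonom = "(nat \<times> nat) \<Rightarrow>\<^sub>0 nat"
type_synonym xpoly = "xmonom \<Rightarrow>\<^sub>0 int poly"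

definition xmon :: "nat \<Rightarrow> nat \<Rightarrow> nat \<Rightarrow> xmonom"  \<comment> \<open>the power $x_{ij}^m$\<close>
  where "xmon i j m = Poly_Mapping.single (i, j) m"

definition xvar :: "nat \<Rightarrow> nat \<Rightarrow> xpoly"
  where "xvar i j = Poly_Mapping.single (xmon i j 1) 1"

definition beta :: "int poly"
  where "beta = [:0, 1:]"

definition xconst :: "int poly \<Rightarrow> xpoly"
  where "xconst c = Poly_Mapping.single 0 c"

text \<open>
  One replacement in a polynomial \<open>p\<close>: a term $c\, M$ of \<open>p\<close> with $M = x_{ij} x_{jk} N$ and
  $i < j < k$ is replaced by $c\, N (x_{ik} x_{ij} + x_{jk} x_{ik} + \beta x_{ik})$.
\<close>

inductive xreplace :: "xpoly \<Rightarrow> xpoly \<Rightarrow> bool" where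
  "\<lbrakk> i < j; j < k; M = xmon i j 1 + xmon j k 1 + N;
     M \<in> Poly_Mapping.keys p; c = Poly_Mapping.lookup p M \<rbrakk> \<Longrightarrow>
   xreplace p (p - Poly_Mapping.single M c
     + Poly_Mapping.single N c
         * (xvar i k * xvar i j + xvar j k * xvar i k + xconst beta * xvar i k))"

definition xreduced :: "xpoly \<Rightarrow> bool"
  where "xreduced p \<longleftrightarrow> (\<forall>M \<in> Poly_Mapping.keys p. \<not> (\<exists>i j k. i < j \<and> j < k
           \<and> (i, j) \<in> Poly_Mapping.keys M \<and> (j, k) \<in> Poly_Mapping.keys M))"

definition reduced_polynomial_of :: "xmonom \<Rightarrow> xpoly \<Rightarrow> bool"
  where "reduced_polynomial_of M q \<longleftrightarrow> xreplace\<^sup>*\<^sup>* (Poly_Mapping.single M 1) q \<and> xreduced q"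

definition xeval :: "(nat \<times> nat \<Rightarrow> int poly) \<Rightarrow> xpoly \<Rightarrow> int poly"
  where "xeval f p = (\<Sum>M \<in> Poly_Mapping.keys p. Poly_Mapping.lookup p M
           * (\<Prod>e \<in> Poly_Mapping.keys M. f e ^ Poly_Mapping.lookup M e))"

text \<open>
  The value $P_M(\beta)$. A monomial may have several reduced polynomials, depending on the order of
  the replacements, but all of them take the same value at $x_{ij} = 1$: see \<open>P_red_unique\<close> and
  \<open>P_red_eq\<close> below. Hence the order (for instance, starting from the leftmost variables) need not
  be fixed.
\<close>

definition P_red :: "xmonom \<Rightarrow> int poly"
  where "P_red M = (THE v. \<exists>q. reduced_polynomial_of M q \<and> v = xeval (\<lambda>_. 1) q)"

definition symmetric_poly :: "'a::zero poly \<Rightarrow> bool"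
  where "symmetric_poly p \<longleftrightarrow> (\<forall>i \<le> degree p. coeff p i = coeff p (degree p - i))"


section \<open>Delannoy paths\<close>

datatype delannoy_step = StepE | StepN | StepNE

primrec step_vec :: "delannoy_step \<Rightarrow> nat \<times> nat" where
  "step_vec StepE = (1, 0)"
| "step_vec StepN = (0, 1)"
| "step_vec StepNE = (1, 1)"

definition delannoy_paths :: "nat \<Rightarrow> nat \<Rightarrow> delannoy_step list set"
  where "delannoy_paths n m = {w. sum_list (map step_vec w) = (n, m)}"


section \<open>The value of the reduced polynomial does not depend on the order of replacements\<close>

text \<open>
  Read a monomial as a multigraph on the vertices \<open>{..<B}\<close>. The series counting the edge weightings
  (flows) by the sum over the vertices of the positive part of outflow minus inflow, multiplied by
  $(1 - z)^{\deg}$, is compatible with the replacement rule for $\beta = z - 1$ and equals 1 on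
  monomials containing no product $x_{ij} x_{jk}$.
\<close>

fun net :: "(nat \<times> nat) list \<Rightarrow> nat list \<Rightarrow> nat \<Rightarrow> int" where
  "net (e # es) (a # fs) v =
     (if v = fst e then int a else 0) - (if v = snd e then int a else 0) + net es fs v"
| "net _ _ v = 0"

definition cost :: "nat \<Rightarrow> (nat \<times> nat) list \<Rightarrow> nat list \<Rightarrow> nat"
  where "cost B es fs = (\<Sum>v<B. nat (net es fs v))"

definition flows :: "nat \<Rightarrow> (nat \<times> nat) list \<Rightarrow> nat \<Rightarrow> nat list set"
  where "flows B es t = {fs. length fs = length es \<and> cost B es fs = t}"

definition flow_series :: "nat \<Rightarrow> (nat \<times> nat) list \<Rightarrow> int fps"
  where "flow_series B es = Abs_fps (\<lambda>t. int (card (flows B es t)))"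

definition flow_h :: "nat \<Rightarrow> (nat \<times> nat) list \<Rightarrow> int fps"
  where "flow_h B es = (1 - fps_X) ^ length es * flow_series B es"

definition valid_edges :: "nat \<Rightarrow> (nat \<times> nat) set \<Rightarrow> bool"
  where "valid_edges B E \<longleftrightarrow> (\<forall>e \<in> E. fst e < snd e \<and> snd e < B)"

lemma valid_edges_Un: "valid_edges B (E \<union> F) \<longleftrightarrow> valid_edges B E \<and> valid_edges B F"
  by (auto simp: valid_edges_def)

lemma net_potential:
  assumes "length fs = length es" "valid_edges B (set es)"
  shows "int (sum_list fs) \<le> (\<Sum>v<B. (int B - int v) * net es fs v)"
  using assms
proof (induction fs es rule: list_induct2)
  case Nil
  then show ?case by simp
next
  case (Cons a fs e es)
  obtain i j where e: "e = (i, j)" by (cases e)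
  have ij: "i < j" "j < B" using Cons.prems e by (auto simp: valid_edges_def)
  have "(\<Sum>v<B. (int B - int v) * net (e # es) (a # fs) v) =
      (\<Sum>v<B. (if v = i then (int B - int v) * int a else 0)) -
      (\<Sum>v<B. (if v = j then (int B - int v) * int a else 0)) +
      (\<Sum>v<B. (int B - int v) * net es fs v)"
    unfolding sum.distrib[symmetric] sum_subtractf[symmetric]
    by (rule sum.cong) (auto simp: e algebra_simps)
  also have "\<dots> = (int j - int i) * int a + (\<Sum>v<B. (int B - int v) * net es fs v)"
    using ij by (simp add: algebra_simps)
  also have "\<dots> \<ge> int a + int (sum_list fs)"
  proof -
    have "1 * int a \<le> (int j - int i) * int a"
      using ij by (intro mult_right_mono) auto
    moreover have "valid_edges B (set es)" using Cons.prems by (auto simp: valid_edges_def)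
    ultimately show ?thesis using Cons.IH by simp
  qed
  finally show ?case by simp
qed

lemma finite_flows:
  assumes "valid_edges B (set es)"
  shows "finite (flows B es t)"
proof (rule finite_subset)
  show "flows B es t \<subseteq> {fs. set fs \<subseteq> {..B * t} \<and> length fs = length es}"
  proof (intro subsetI CollectI conjI)
    fix fs a assume fs: "fs \<in> flows B es t"
    then show "length fs = length es" by (simp add: flows_def)
    assume a: "a \<in> set fs"
    have "int (sum_list fs) \<le> (\<Sum>v<B. (int B - int v) * net es fs v)"
      using fs assms by (intro net_potential) (auto simp: flows_def)
    also have "\<dots> \<le> (\<Sum>v<B. int B * int (nat (net es fs v)))"
    proof (rule sum_mono)
      fix v assume "v \<in> {..<B}"
      then show "(int B - int v) * net es fs v \<le> int B * int (nat (net es fs v))"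
        by (cases "net es fs v \<ge> 0") (auto intro: mult_right_mono mult_nonneg_nonpos)
    qed
    also have "\<dots> = int (B * cost B es fs)"
      by (simp add: cost_def sum_distrib_left)
    finally have "sum_list fs \<le> B * t"
      using fs unfolding of_nat_le_iff by (simp add: flows_def)
    with member_le_sum_list[OF a] show "a \<in> {..B * t}" by simp
  qed
  show "finite {fs. set fs \<subseteq> {..B * t} \<and> length fs = length es}"
    by (intro finite_lists_length_eq) auto
qed

lemma net_alt:
  assumes "length fs = length es"
  shows "net es fs v = sum_list (map (\<lambda>(e, a).
     (if v = fst e then int a else 0) - (if v = snd e then int a else 0)) (zip es fs))"
  using assms by (induction fs es rule: list_induct2) auto

lemma net_permute:
  assumes "length fs = length es" "p permutes {..<length es}"
  shows "net (permute_list p es) (permute_list p fs) v = net es fs v"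
proof -
  have "mset (zip (permute_list p es) (permute_list p fs)) = mset (permute_list p (zip es fs))"
    using assms by (subst permute_list_zip) auto
  also have "\<dots> = mset (zip es fs)"
    using assms by (intro mset_permute_list) auto
  finally have *: "mset (zip (permute_list p es) (permute_list p fs)) = mset (zip es fs)" .
  have sm: "sum_list (map g xs) = sum_mset (image_mset g (mset xs))" for g :: "_ \<Rightarrow> int" and xs
    by (simp flip: mset_map add: sum_mset_sum_list)
  have "length (permute_list p fs) = length (permute_list p es)" using assms by simp
  then show ?thesis
    using assms(1) by (simp only: net_alt sm *)
qed

lemma flow_series_mset:
  assumes "mset es = mset es'" "valid_edges B (set es)"
  shows "flow_series B es = flow_series B es'"
proof -
  have le: "card (flows B es' t) \<le> card (flows B es t)"
    if asm: "mset es = mset es'" "valid_edges B (set es)" for t es es'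
  proof -
    obtain p where p: "p permutes {..<length es'}" "permute_list p es' = es"
      using mset_eq_permutation[OF asm(1)] by blast
    have len: "length es = length es'" using asm(1) by (rule mset_eq_length)
    have p_inj: "inj_on (permute_list p) (flows B es' t)"
    proof (rule inj_onI)
      fix x y assume xy: "x \<in> flows B es' t" "y \<in> flows B es' t" "permute_list p x = permute_list p y"
      have lx: "length x = length es'" "length y = length es'" using xy by (auto simp: flows_def)
      show "x = y"
      proof (rule nth_equalityI)
        show "length x = length y" using lx by simp
        fix i assume i: "i < length x"
        have "inv p permutes {..<length es'}" using p(1) by (rule permutes_inv)
        then have "inv p i < length es'" using i lx permutes_in_image[of "inv p" "{..<length es'}" i] by auto
        then have "permute_list p x ! inv p i = x ! i" "permute_list p y ! inv p i = y ! i"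
          using p(1) lx by (auto simp: permute_list_nth permutes_inverses)
        with xy(3) show "x ! i = y ! i" by simp
      qed
    qed
    have "permute_list p ` flows B es' t \<subseteq> flows B es t"
    proof (rule image_subsetI)
      fix fs assume fs: "fs \<in> flows B es' t"
      have "net es (permute_list p fs) v = net es' fs v" for v
        using net_permute[of fs es' p v] fs p by (simp add: flows_def)
      with fs len show "permute_list p fs \<in> flows B es t" by (simp add: flows_def cost_def)
    qed
    with p_inj show ?thesis using finite_flows[OF asm(2)] by (metis card_inj_on_le)
  qed
  have "set es = set es'" using assms(1) by (metis set_mset_mset)
  then have "card (flows B es t) = card (flows B es' t)" for t
    using le[of es es' t] le[of es' es t] assms by (simp add: le_antisym)
  then show ?thesis by (simp add: flow_series_def)
qed

lemma flows_pair:
  assumes "valid_edges B (set ((i, j) # (j, k) # es))"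
  shows "card (flows B ((i, j) # (j, k) # es) t) + card (flows B ((i, k) # es) t) =
         card (flows B ((i, k) # (i, j) # es) t) + card (flows B ((i, k) # (j, k) # es) t)"
proof -
  define g0 :: "nat list \<Rightarrow> nat list" where "g0 = (\<lambda>fs. hd fs # hd fs # tl fs)"
  define g1 :: "nat list \<Rightarrow> nat list" where "g1 = (\<lambda>fs. (hd fs + hd (tl fs)) # hd fs # tl (tl fs))"
  define g2 :: "nat list \<Rightarrow> nat list" where "g2 = (\<lambda>fs. hd fs # (hd fs + hd (tl fs)) # tl (tl fs))"
  let ?F = "flows B ((i, j) # (j, k) # es) t"
  let ?G = "flows B ((i, k) # es) t"
  let ?Ga = "flows B ((i, k) # (i, j) # es) t"
  let ?Gb = "flows B ((i, k) # (j, k) # es) t"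
  have c0: "cost B ((i, j) # (j, k) # es) (c # c # fs) = cost B ((i, k) # es) (c # fs)" for c fs
    unfolding cost_def by (intro sum.cong) (auto intro!: arg_cong[where f = nat])
  have c1: "cost B ((i, j) # (j, k) # es) ((c + a) # c # fs) =
      cost B ((i, k) # (i, j) # es) (c # a # fs)" for a c fs
    unfolding cost_def by (intro sum.cong) (auto intro!: arg_cong[where f = nat])
  have c2: "cost B ((i, j) # (j, k) # es) (c # (c + b) # fs) =
      cost B ((i, k) # (j, k) # es) (c # b # fs)" for b c fs
    unfolding cost_def by (intro sum.cong) (auto intro!: arg_cong[where f = nat])
  have f0: "\<exists>c fs. x = c # fs" if "x \<in> ?G" for x
    using that by (cases x) (simp_all add: flows_def)
  have f1: "\<exists>c a fs. x = c # a # fs" if "length x = Suc (Suc (length es))" for x :: "nat list"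
    using that by (cases x; cases "tl x") simp_all
  have i0: "inj_on g0 ?G"
  proof (rule inj_onI)
    fix x y assume "x \<in> ?G" "y \<in> ?G" "g0 x = g0 y"
    moreover then obtain c fs d gs where "x = c # fs" "y = d # gs" using f0 by metis
    ultimately show "x = y" by (simp add: g0_def)
  qed
  have i1: "inj_on g1 ?Ga"
  proof (rule inj_onI)
    fix x y assume xy: "x \<in> ?Ga" "y \<in> ?Ga" "g1 x = g1 y"
    then obtain c a fs d b gs where "x = c # a # fs" "y = d # b # gs"
      using f1[of x] f1[of y] by (auto simp: flows_def)
    with xy(3) show "x = y" by (simp add: g1_def)
  qed
  have i2: "inj_on g2 ?Gb"
  proof (rule inj_onI)
    fix x y assume xy: "x \<in> ?Gb" "y \<in> ?Gb" "g2 x = g2 y"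
    then obtain c a fs d b gs where "x = c # a # fs" "y = d # b # gs"
      using f1[of x] f1[of y] by (auto simp: flows_def)
    with xy(3) show "x = y" by (simp add: g2_def)
  qed
  have m0: "g0 ` ?G = {fs \<in> ?F. fs ! 0 = fs ! 1}" (is "_ = ?E")
  proof (intro equalityI subsetI)
    fix x assume "x \<in> g0 ` ?G"
    then obtain y where y: "y \<in> ?G" "x = g0 y" by blast
    moreover obtain c fs where "y = c # fs" using f0[OF y(1)] by blast
    ultimately show "x \<in> ?E" by (simp add: g0_def flows_def c0)
  next
    fix x assume x: "x \<in> ?E"
    then obtain c fs where xe: "x = c # c # fs" using f1[of x] by (auto simp: flows_def)
    have "c # fs \<in> ?G" using x by (simp add: xe flows_def c0)
    moreover have "x = g0 (c # fs)" by (simp add: g0_def xe)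
    ultimately show "x \<in> g0 ` ?G" by blast
  qed
  have m1: "g1 ` ?Ga = {fs \<in> ?F. fs ! 0 \<ge> fs ! 1}" (is "_ = ?Ea")
  proof (intro equalityI subsetI)
    fix x assume "x \<in> g1 ` ?Ga"
    then obtain y where y: "y \<in> ?Ga" "x = g1 y" by blast
    moreover obtain c a fs where "y = c # a # fs" using f1[of y] y(1) by (auto simp: flows_def)
    ultimately show "x \<in> ?Ea" by (simp add: g1_def flows_def c1)
  next
    fix x assume x: "x \<in> ?Ea"
    then obtain a c fs where "x = a # c # fs" "c \<le> a"
      using f1[of x] by (auto simp: flows_def)
    then have xe: "x = (c + (a - c)) # c # fs" by simp
    have "c # (a - c) # fs \<in> ?Ga"
      using x unfolding xe by (simp add: flows_def c1 del: le_add_diff_inverse)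
    moreover have "x = g1 (c # (a - c) # fs)" by (simp add: g1_def xe)
    ultimately show "x \<in> g1 ` ?Ga" by blast
  qed
  have m2: "g2 ` ?Gb = {fs \<in> ?F. fs ! 0 \<le> fs ! 1}" (is "_ = ?Eb")
  proof (intro equalityI subsetI)
    fix x assume "x \<in> g2 ` ?Gb"
    then obtain y where y: "y \<in> ?Gb" "x = g2 y" by blast
    moreover obtain c a fs where "y = c # a # fs" using f1[of y] y(1) by (auto simp: flows_def)
    ultimately show "x \<in> ?Eb" by (simp add: g2_def flows_def c2)
  next
    fix x assume x: "x \<in> ?Eb"
    then obtain b c fs where "x = c # b # fs" "c \<le> b"
      using f1[of x] by (auto simp: flows_def)
    then have xe: "x = c # (c + (b - c)) # fs" by simp
    have "c # (b - c) # fs \<in> ?Gb"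
      using x unfolding xe by (simp add: flows_def c2 del: le_add_diff_inverse)
    moreover have "x = g2 (c # (b - c) # fs)" by (simp add: g2_def xe)
    ultimately show "x \<in> g2 ` ?Gb" by blast
  qed
  have fin: "finite ?F" using assms by (rule finite_flows)
  have "card ?Ea + card ?Eb = card (?Ea \<union> ?Eb) + card (?Ea \<inter> ?Eb)"
    using fin by (intro card_Un_Int) auto
  moreover have "?Ea \<union> ?Eb = ?F" by auto
  moreover have "?Ea \<inter> ?Eb = ?E" by auto
  ultimately have "card ?Ea + card ?Eb = card ?F + card ?E" by simp
  moreover have "card ?E = card ?G" unfolding m0[symmetric] by (rule card_image[OF i0])
  moreover have "card ?Ea = card ?Ga" unfolding m1[symmetric] by (rule card_image[OF i1])
  moreover have "card ?Eb = card ?Gb" unfolding m2[symmetric] by (rule card_image[OF i2])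
  ultimately show ?thesis by simp
qed

lemma flow_h_pair:
  assumes "valid_edges B (set ((i, j) # (j, k) # es))"
  shows "flow_h B ((i, j) # (j, k) # es) =
    flow_h B ((i, k) # (i, j) # es) + flow_h B ((i, k) # (j, k) # es)
      + (fps_X - 1) * flow_h B ((i, k) # es)"
proof -
  have "flow_series B ((i, j) # (j, k) # es) =
      flow_series B ((i, k) # (i, j) # es) + flow_series B ((i, k) # (j, k) # es)
      - flow_series B ((i, k) # es)"
  proof (rule fps_ext)
    fix t
    show "fps_nth (flow_series B ((i, j) # (j, k) # es)) t =
      fps_nth (flow_series B ((i, k) # (i, j) # es) + flow_series B ((i, k) # (j, k) # es)
      - flow_series B ((i, k) # es)) t"
      using flows_pair[OF assms, of t] by (simp add: flow_series_def)
  qed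
  then show ?thesis unfolding flow_h_def by (simp only:) (simp add: algebra_simps)
qed

lemma cost_alternating:
  assumes "length fs = length es" "valid_edges B (set es)"
    and "\<And>i j k. (i, j) \<in> set es \<Longrightarrow> (j, k) \<in> set es \<Longrightarrow> False"
  shows "cost B es fs = sum_list fs"
proof -
  define out where "out v = sum_list (map (\<lambda>(e, a). if v = fst e then a else 0) (zip es fs))" for v
  define inn where "inn v = sum_list (map (\<lambda>(e, a). if v = snd e then a else 0) (zip es fs))" for v
  have net: "net es fs v = int (out v) - int (inn v)" for v
    unfolding out_def inn_def using assms(1)
    by (induction fs es rule: list_induct2) auto
  have "nat (net es fs v) = out v" for v
  proof (cases "v \<in> fst ` set es")
    case True
    then have "v \<notin> snd ` set es" using assms(3) by force
    then have "inn v = 0" unfolding inn_def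
      by (force intro!: sum_list_0 dest: set_zip_leftD simp: sum_list_eq_0_iff)
    then show ?thesis by (simp add: net)
  next
    case False
    then have "out v = 0" unfolding out_def
      by (force intro!: sum_list_0 dest: set_zip_leftD simp: sum_list_eq_0_iff)
    then show ?thesis by (simp add: net)
  qed
  then have "cost B es fs = (\<Sum>v<B. out v)" by (simp add: cost_def)
  also have "\<dots> = sum_list fs"
    unfolding out_def using assms(1,2)
  proof (induction fs es rule: list_induct2)
    case (Cons a fs e es)
    then have "fst e < B" "valid_edges B (set es)" by (auto simp: valid_edges_def)
    with Cons.IH show ?case by (simp add: sum.distrib)
  qed simp
  finally show ?thesis .
qed

lemma compositions_series:
  "(1 - fps_X) ^ n * Abs_fps (\<lambda>t. int (card {fs. length fs = n \<and> sum_list fs = t})) = (1 :: int fps)"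
proof (induction n)
  case 0
  have "{fs :: nat list. length fs = 0 \<and> sum_list fs = t} = (if t = 0 then {[]} else {})" for t
    by auto
  then have "int (card {fs :: nat list. length fs = 0 \<and> sum_list fs = t}) = (if t = 0 then 1 else 0)" for t
    by simp
  then show ?case by (intro fps_ext) (simp del: length_0_conv)
next
  case (Suc n)
  let ?K = "\<lambda>n. Abs_fps (\<lambda>t. int (card {fs. length fs = n \<and> sum_list fs = (t::nat)}))"
  have "(1 - fps_X) * ?K (Suc n) = ?K n"
  proof (rule fps_ext)
    fix t
    show "fps_nth ((1 - fps_X) * ?K (Suc n)) t = fps_nth (?K n) t"
    proof (cases t)
      case 0
      then show ?thesis by (simp add: left_diff_distrib card_length_sum_list)
    next
      case (Suc s)
      then show ?thesis by (simp add: left_diff_distrib card_length_sum_list del: binomial_Suc_Suc)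
         (simp add: add.commute)
    qed
  qed
  then show ?case using Suc by (simp add: mult.assoc mult.left_commute[of "1 - fps_X"])
qed

lemma flow_h_alternating:
  assumes "valid_edges B (set es)"
    and "\<And>i j k. (i, j) \<in> set es \<Longrightarrow> (j, k) \<in> set es \<Longrightarrow> False"
  shows "flow_h B es = 1"
proof -
  have "flows B es t = {fs. length fs = length es \<and> sum_list fs = t}" for t
    using cost_alternating[OF _ assms] by (auto simp: flows_def)
  then show ?thesis by (simp add: flow_h_def flow_series_def compositions_series)
qed

definition edge_list :: "xmonom \<Rightarrow> (nat \<times> nat) list"
  where "edge_list M = (SOME es. \<forall>e. count (mset es) e = Poly_Mapping.lookup M e)"

lemma count_edge_list: "count (mset (edge_list M)) e = Poly_Mapping.lookup M e"
proof -
  obtain es where "mset es = Abs_multiset (Poly_Mapping.lookup M)" using ex_mset by blast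
  then have "\<forall>e. count (mset es) e = Poly_Mapping.lookup M e"
    by (simp add: Abs_multiset_inverse)
  then show ?thesis unfolding edge_list_def by (rule someI2) blast
qed

lemma set_edge_list: "set (edge_list M) = Poly_Mapping.keys M"
proof -
  have "e \<in> set (edge_list M) \<longleftrightarrow> e \<in> Poly_Mapping.keys M" for e
    using count_greater_zero_iff[of "mset (edge_list M)" e] by (simp add: count_edge_list in_keys_iff)
  then show ?thesis by blast
qed

definition mon_h :: "nat \<Rightarrow> xmonom \<Rightarrow> int fps"
  where "mon_h B M = flow_h B (edge_list M)"

lemma mon_h_eq:
  assumes "\<And>e. count (mset es) e = Poly_Mapping.lookup M e" "valid_edges B (Poly_Mapping.keys M)"
  shows "mon_h B M = flow_h B es"
proof -
  have ms: "mset (edge_list M) = mset es"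
    using assms(1) by (intro multiset_eqI) (simp add: count_edge_list)
  show ?thesis
    unfolding mon_h_def flow_h_def
    using flow_series_mset[OF ms, of B] assms(2) mset_eq_length[OF ms] by (simp add: set_edge_list)
qed

lemma keys_add_nat:
  "Poly_Mapping.keys (M + N :: xmonom) = Poly_Mapping.keys M \<union> Poly_Mapping.keys N"
  by (auto simp: in_keys_iff lookup_add)

lemma keys_xmon [simp]: "Poly_Mapping.keys (xmon i j (Suc 0)) = {(i, j)}"
  by (simp add: xmon_def)

lemma mon_h_pair:
  assumes "i < j" "j < k" "valid_edges B (Poly_Mapping.keys (xmon i j 1 + xmon j k 1 + N))"
  shows "mon_h B (xmon i j 1 + xmon j k 1 + N) =
    mon_h B (xmon i k 1 + xmon i j 1 + N) + mon_h B (xmon i k 1 + xmon j k 1 + N)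
      + (fps_X - 1) * mon_h B (xmon i k 1 + N)"
proof -
  have v: "valid_edges B (Poly_Mapping.keys N)" "k < B"
    using assms by (auto simp: valid_edges_def keys_add_nat)
  have l: "Poly_Mapping.lookup (xmon a b (Suc 0)) e = (if e = (a, b) then 1 else 0)" for a b e
    by (simp add: xmon_def lookup_single when_def)
  have "mon_h B (xmon i j 1 + xmon j k 1 + N) = flow_h B ((i, j) # (j, k) # edge_list N)"
    using v assms by (intro mon_h_eq) (auto simp: valid_edges_def keys_add_nat lookup_add l count_edge_list)
  moreover have "mon_h B (xmon i k 1 + xmon i j 1 + N) = flow_h B ((i, k) # (i, j) # edge_list N)"
    using v assms by (intro mon_h_eq) (auto simp: valid_edges_def keys_add_nat lookup_add l count_edge_list)
  moreover have "mon_h B (xmon i k 1 + xmon j k 1 + N) = flow_h B ((i, k) # (j, k) # edge_list N)"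
    using v assms by (intro mon_h_eq) (auto simp: valid_edges_def keys_add_nat lookup_add l count_edge_list)
  moreover have "mon_h B (xmon i k 1 + N) = flow_h B ((i, k) # edge_list N)"
    using v assms by (intro mon_h_eq) (auto simp: valid_edges_def keys_add_nat lookup_add l count_edge_list)
  moreover have "valid_edges B (set ((i, j) # (j, k) # edge_list N))"
    using v assms by (auto simp: valid_edges_def set_edge_list)
  ultimately show ?thesis using flow_h_pair by metis
qed

definition shift_fps :: "int poly \<Rightarrow> int fps"
  where "shift_fps c = fps_of_poly (pcompose c [:-1, 1:])"

lemma shift_fps_add: "shift_fps (a + b) = shift_fps a + shift_fps b"
  and shift_fps_diff: "shift_fps (a - b) = shift_fps a - shift_fps b"
  and shift_fps_mult: "shift_fps (a * b) = shift_fps a * shift_fps b"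
  and shift_fps_0 [simp]: "shift_fps 0 = 0"
  by (simp_all add: shift_fps_def pcompose_add pcompose_diff pcompose_mult fps_of_poly_add
        fps_of_poly_diff fps_of_poly_mult)

lemma shift_fps_beta: "shift_fps beta = fps_X - 1"
  by (simp add: shift_fps_def beta_def pcompose_pCons fps_of_poly_pCons)

lemma shift_fps_sum: "shift_fps (sum f A) = (\<Sum>x\<in>A. shift_fps (f x))"
  by (induction A rule: infinite_finite_induct) (auto simp: shift_fps_add)

lemma shift_fps_inj: "shift_fps a = shift_fps b \<Longrightarrow> a = b"
proof -
  assume "shift_fps a = shift_fps b"
  then have "pcompose (pcompose a [:-1, 1:]) [:1, 1:] = pcompose (pcompose b [:-1, 1:]) [:1, 1:]"
    by (simp add: shift_fps_def)
  moreover have "pcompose (pcompose c [:-1, 1:]) [:1, 1:] = c" for c :: "int poly"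
    by (simp add: pcompose_assoc[symmetric] pcompose_pCons pcompose_idR)
  ultimately show ?thesis by simp
qed

definition xpoly_h :: "nat \<Rightarrow> xpoly \<Rightarrow> int fps"
  where "xpoly_h B p = (\<Sum>M \<in> Poly_Mapping.keys p. shift_fps (Poly_Mapping.lookup p M) * mon_h B M)"

lemma xpoly_h_add: "xpoly_h B (p + q) = xpoly_h B p + xpoly_h B q"
  unfolding xpoly_h_def
  by (rule setsum_keys_plus_distrib) (auto simp: shift_fps_add algebra_simps)

lemma xpoly_h_diff: "xpoly_h B (p - q) = xpoly_h B p - xpoly_h B q"
  using xpoly_h_add[of B "p - q" q] by simp

lemma xpoly_h_single: "xpoly_h B (Poly_Mapping.single M c) = shift_fps c * mon_h B M"
  by (simp add: xpoly_h_def)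

lemma xreplace_expand:
  "Poly_Mapping.single N c * (xvar i k * xvar i j + xvar j k * xvar i k + xconst beta * xvar i k) =
   Poly_Mapping.single (xmon i k 1 + xmon i j 1 + N) c +
   Poly_Mapping.single (xmon i k 1 + xmon j k 1 + N) c +
   Poly_Mapping.single (xmon i k 1 + N) (c * beta)"
  by (simp add: xvar_def xconst_def mult_single distrib_left add_ac)

definition valid_xpoly :: "nat \<Rightarrow> xpoly \<Rightarrow> bool"
  where "valid_xpoly B p \<longleftrightarrow> (\<forall>M \<in> Poly_Mapping.keys p. valid_edges B (Poly_Mapping.keys M))"

lemma xreplace_h:
  assumes "xreplace p q" "valid_xpoly B p"
  shows "xpoly_h B q = xpoly_h B p"
  using assms
proof cases
  case (1 i j k M N c)
  have "valid_edges B (Poly_Mapping.keys (xmon i j 1 + xmon j k 1 + N))"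
    using 1 assms(2) by (auto simp: valid_xpoly_def)
  note h = mon_h_pair[OF 1(2,3) this, folded 1(4)]
  show ?thesis
    unfolding 1(1) xreplace_expand xpoly_h_add xpoly_h_diff xpoly_h_single h 1(6)[symmetric]
    by (simp add: xpoly_h_add xpoly_h_diff xpoly_h_single shift_fps_mult shift_fps_beta algebra_simps)
qed

lemma xreplace_keys:
  assumes "i < j" "j < k" "M = xmon i j 1 + xmon j k 1 + N" "c = Poly_Mapping.lookup p M"
  shows "Poly_Mapping.keys (p - Poly_Mapping.single M c
     + Poly_Mapping.single N c * (xvar i k * xvar i j + xvar j k * xvar i k + xconst beta * xvar i k))
   \<subseteq> (Poly_Mapping.keys p - {M}) \<union>
     {xmon i k 1 + xmon i j 1 + N, xmon i k 1 + xmon j k 1 + N, xmon i k 1 + N}"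
  unfolding xreplace_expand using assms(4)
  by (auto simp: in_keys_iff lookup_add lookup_minus lookup_single when_def split: if_splits)

lemma xreplace_valid:
  assumes "xreplace p q" "valid_xpoly B p"
  shows "valid_xpoly B q"
  using assms(1)
proof cases
  case (1 i j k M N c)
  have "valid_edges B (Poly_Mapping.keys M)" using 1 assms(2) by (auto simp: valid_xpoly_def)
  then have "k < B" "valid_edges B (Poly_Mapping.keys N)"
    "valid_edges B {(i, j)}" "valid_edges B {(j, k)}" "valid_edges B {(i, k)}"
    using 1 by (auto simp: valid_edges_def keys_add_nat)
  then have "valid_edges B (Poly_Mapping.keys K)" if "K \<in> {xmon i k 1 + xmon i j 1 + N,
      xmon i k 1 + xmon j k 1 + N, xmon i k 1 + N}" for K
    using that by (auto simp: keys_add_nat valid_edges_Un simp del: Un_insert_left Un_insert_right)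
  then show ?thesis
    using xreplace_keys[OF 1(2,3,4,6)] assms(2) unfolding valid_xpoly_def 1(1) by blast
qed

lemma xreplace_rtranclp_valid:
  assumes "xreplace\<^sup>*\<^sup>* p q" "valid_xpoly B p"
  shows "valid_xpoly B q \<and> xpoly_h B q = xpoly_h B p"
  using assms by induction (auto simp: xreplace_valid xreplace_h)

lemma xreduced_h:
  assumes "xreduced q" "valid_xpoly B q"
  shows "xpoly_h B q = shift_fps (xeval (\<lambda>_. 1) q)"
proof -
  have "mon_h B M = 1" if M: "M \<in> Poly_Mapping.keys q" for M
    unfolding mon_h_def
  proof (rule flow_h_alternating)
    show v: "valid_edges B (set (edge_list M))"
      using M assms(2) by (simp add: set_edge_list valid_xpoly_def)
    fix i j k assume e: "(i, j) \<in> set (edge_list M)" "(j, k) \<in> set (edge_list M)"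
    then have "i < j" "j < k" using v by (auto simp: valid_edges_def)
    with e M assms(1) show False by (auto simp: set_edge_list xreduced_def)
  qed
  then show ?thesis by (simp add: xpoly_h_def xeval_def shift_fps_sum)
qed

definition mon_weight :: "nat \<Rightarrow> xmonom \<Rightarrow> nat"
  where "mon_weight B M =
    (\<Sum>e \<in> Poly_Mapping.keys M. Poly_Mapping.lookup M e * (B - (snd e - fst e)))"

lemma mon_weight_add: "mon_weight B (M + N) = mon_weight B M + mon_weight B N"
  unfolding mon_weight_def
  by (rule setsum_keys_plus_distrib) (auto simp: algebra_simps)

lemma mon_weight_xmon: "mon_weight B (xmon i j 1) = B - (j - i)"
  by (simp add: mon_weight_def) (simp add: xmon_def)

definition xpoly_weight :: "nat \<Rightarrow> xpoly \<Rightarrow> nat"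
  where "xpoly_weight B p = (\<Sum>M \<in> Poly_Mapping.keys p. 4 ^ mon_weight B M)"

lemma xreplace_weight:
  assumes "xreplace p q" "valid_xpoly B p"
  shows "xpoly_weight B q < xpoly_weight B p"
  using assms(1)
proof cases
  case (1 i j k M N c)
  let ?S = "{xmon i k 1 + xmon i j 1 + N, xmon i k 1 + xmon j k 1 + N, xmon i k 1 + N}"
  have "valid_edges B (Poly_Mapping.keys M)" using 1 assms(2) by (auto simp: valid_xpoly_def)
  then have "k < B" using 1 by (auto simp: valid_edges_def keys_add_nat)
  then have lt: "mon_weight B K < mon_weight B M" if "K \<in> ?S" for K
    using that 1(2,3) unfolding 1(4)
    by (auto simp: mon_weight_add mon_weight_xmon[unfolded One_nat_def])
  then obtain w where w: "mon_weight B M = Suc w" by (metis insertI1 not0_implies_Suc not_less0)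
  have "xpoly_weight B q \<le> (\<Sum>K \<in> (Poly_Mapping.keys p - {M}) \<union> ?S. 4 ^ mon_weight B K)"
    unfolding xpoly_weight_def 1(1)
    using xreplace_keys[OF 1(2,3,4,6)] by (intro sum_mono2) auto
  also have "\<dots> \<le> (\<Sum>K \<in> Poly_Mapping.keys p - {M}. 4 ^ mon_weight B K) + (\<Sum>K \<in> ?S. 4 ^ mon_weight B K)"
    by (subst sum.union_inter[symmetric]) auto
  also have "(\<Sum>K \<in> ?S. 4 ^ mon_weight B K) \<le> (\<Sum>K \<in> ?S. 4 ^ w :: nat)"
    using lt w by (intro sum_mono power_increasing) (auto simp: less_Suc_eq_le)
  also have "(\<Sum>K \<in> ?S. 4 ^ w :: nat) \<le> 3 * 4 ^ w"
    by (simp add: card_insert_if)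
  also have "3 * 4 ^ w < (4::nat) ^ mon_weight B M" by (simp add: w)
  also have "(\<Sum>K \<in> Poly_Mapping.keys p - {M}. 4 ^ mon_weight B K) + (4::nat) ^ mon_weight B M
      = xpoly_weight B p"
    unfolding xpoly_weight_def using 1(5) by (subst sum.remove[of _ M]) auto
  finally show ?thesis by simp
qed

lemma xreduced_exists:
  assumes "valid_xpoly B p"
  shows "\<exists>q. xreplace\<^sup>*\<^sup>* p q \<and> xreduced q"
  using assms
proof (induction "xpoly_weight B p" arbitrary: p rule: less_induct)
  case less
  show ?case
  proof (cases "xreduced p")
    case True
    then show ?thesis by blast
  next
    case False
    then obtain M i j k where M: "M \<in> Poly_Mapping.keys p" "i < j" "j < k"
      "(i, j) \<in> Poly_Mapping.keys M" "(j, k) \<in> Poly_Mapping.keys M"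
      unfolding xreduced_def by blast
    have "M = xmon i j 1 + xmon j k 1 + (M - (xmon i j 1 + xmon j k 1))"
      using M by (intro poly_mapping_eqI)
        (auto simp: lookup_add lookup_minus xmon_def lookup_single when_def in_keys_iff)
    from xreplace.intros[OF M(2,3) this M(1) refl] obtain p' where p': "xreplace p p'" by blast
    from less.hyps[OF xreplace_weight[OF p' less.prems] xreplace_valid[OF p' less.prems]]
    show ?thesis using p' by (meson converse_rtranclp_into_rtranclp)
  qed
qed

lemma valid_bound:
  assumes "\<And>i j. (i, j) \<in> Poly_Mapping.keys M \<Longrightarrow> i < j"
  obtains B where "valid_xpoly B (Poly_Mapping.single M 1)"
proof
  show "valid_xpoly (Suc (Max (snd ` Poly_Mapping.keys M))) (Poly_Mapping.single M 1)"
    using assms by (auto simp: valid_xpoly_def valid_edges_def less_Suc_eq_le)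
qed

theorem P_red_unique:
  assumes "\<And>i j. (i, j) \<in> Poly_Mapping.keys M \<Longrightarrow> i < j"
  shows "\<exists>!v. \<exists>q. reduced_polynomial_of M q \<and> v = xeval (\<lambda>_. 1) q"
proof -
  obtain B where B: "valid_xpoly B (Poly_Mapping.single M 1)" using valid_bound[OF assms] by blast
  have "shift_fps (xeval (\<lambda>_. 1) q) = xpoly_h B (Poly_Mapping.single M 1)"
    if "reduced_polynomial_of M q" for q
  proof -
    have q: "xreplace\<^sup>*\<^sup>* (Poly_Mapping.single M 1) q" "xreduced q"
      using that by (auto simp: reduced_polynomial_of_def)
    note h = xreplace_rtranclp_valid[OF q(1) B]
    show ?thesis using xreduced_h[OF q(2) conjunct1[OF h]] conjunct2[OF h] by (rule trans[OF sym])
  qed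
  then have "xeval (\<lambda>_. 1) q = xeval (\<lambda>_. 1) q'"
    if "reduced_polynomial_of M q" "reduced_polynomial_of M q'" for q q'
    using that shift_fps_inj by metis
  moreover have "\<exists>q. reduced_polynomial_of M q"
    using xreduced_exists[OF B] by (simp add: reduced_polynomial_of_def)
  ultimately show ?thesis by blast
qed

theorem P_red_eq:
  assumes "\<And>i j. (i, j) \<in> Poly_Mapping.keys M \<Longrightarrow> i < j" "reduced_polynomial_of M q"
  shows "P_red M = xeval (\<lambda>_. 1) q"
  unfolding P_red_def using P_red_unique[OF assms(1)] assms(2) by (intro the1_equality) auto

end

theory Submission
  imports Defs
begin

text \<open>
  Write $z = 1 + \beta$ and let $\varphi$ be the linear functional on polynomials in the $x_{ij}$
  over $\mathbb{Z}[z]$ that sends a monomial $M$ to $P_M(z - 1)$. It vanishes on the ideal generated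
  by the relations $x_{ij} x_{jk} = x_{ik} (x_{ij} + x_{jk} + z - 1)$ and equals 1 on the monomials
  that admit no replacement.

  \<^bold>\<open>Positivity and reversal.\<close> In the variables $y_{ij} = x_{ij} - 1$ the relation becomes
  $y_{ij} y_{jk} = y_{ik} y_{ij} + y_{ik} y_{jk} + (1 + z) y_{ik} + z$, with non-negative
  coefficients, and $\varphi$ vanishes on every non-trivial monomial in the $y_{ij}$ that admits no
  replacement. Hence $\varphi(y^M)$ has non-negative coefficients. In this relation the coefficient
  $c(z)$ of a monomial with $r$ factors satisfies $z^{2-r} c(1/z) = c(z)$, so, by induction,
  $z^{|M|} \varphi(y^M)(1/z) = \varphi(y^M)$ (\<open>yprod_nonneg_palindromic\<close>).
  Expanding $\prod_M x_e = \prod_M (1 + y_e)$, the polynomial $\varphi(x^M)$ has non-negative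
  coefficients, and reversing it in degree $|M|$ gives $\varphi(\prod_M z_e)$ with
  $z_e = z + y_e$ (\<open>yprod_xprod_reverses\<close>).

  \<^bold>\<open>Symmetry for paths.\<close> Modulo the ideal,
  $x_{ij} x_{jk} = x_{ik} (x_{ij} + z_{jk})$ and $z_{ij} z_{jk} = z_{ik} (x_{ij} + z_{jk})$ have the
  same cofactor. By induction there is a single $Q$ with $\prod_l x_{l,l+1} = x_{1n} Q$ and
  $\prod_l z_{l,l+1} = z_{1n} Q$ (\<open>path_factor\<close>). On the vertices $1, \dots, n$ the
  variable $x_{1n}$ takes part in no replacement, so it acts under $\varphi$ as 1, and $z_{1n}$ acts
  as $z$ (\<open>h_lin_outer_arc_power\<close>). Therefore
  $\varphi((\prod_l z_{l,l+1})^m) = z^m \varphi((\prod_l x_{l,l+1})^m)$, and together with the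
  reversal and the non-vanishing of the constant coefficient this makes
  $\varphi((\prod_l x_{l,l+1})^m)$ symmetric, of degree $m(n-2)$ if $n \geq 2$.

  \<^bold>\<open>Delannoy paths.\<close> The same triviality of $x_{13}$ turns the replacement of
  $x_{12} x_{23}$ into the recursion $P_{n+1,m+1} = P_{n+1,m} + P_{n,m+1} + \beta P_{n,m}$ for the
  values $P_{n,m}$ of the monomials $x_{12}^n x_{23}^m$. It is also satisfied by both binomial sums and by the generating polynomial of the Delannoy paths.
\<close>

section \<open>The values on monomials\<close>

text \<open>The index pairs of the variables $x_{ij}$ with $a \leq i < j \leq b$.\<close>

definition arcs :: "nat \<Rightarrow> nat \<Rightarrow> (nat \<times> nat) set"
  where "arcs a b = {(i, j). a \<le> i \<and> i < j \<and> j \<le> b}"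

text \<open>
  The invariance under replacements identifies \<open>P_red\<close>, up to the shift of $\beta$, with the
  normalised flow series, from which it inherits the replacement rule.
\<close>

lemma P_red_mon_h:
  assumes "Poly_Mapping.keys M \<subseteq> arcs a b"
  shows "shift_fps (P_red M) = mon_h (Suc b) M"
proof -
  have lt: "i < j" if "(i, j) \<in> Poly_Mapping.keys M" for i j
    using assms that by (auto simp: arcs_def)
  have v: "valid_xpoly (Suc b) (Poly_Mapping.single M 1)"
    using assms by (auto simp: valid_xpoly_def valid_edges_def arcs_def)
  obtain q where q: "reduced_polynomial_of M q" using P_red_unique[OF lt] by blast
  then have "xreplace\<^sup>*\<^sup>* (Poly_Mapping.single M 1) q" "xreduced q"
    by (simp_all add: reduced_polynomial_of_def)
  moreover have "shift_fps 1 = 1" by (simp add: shift_fps_def pcompose_1)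
  ultimately show ?thesis
    using xreplace_rtranclp_valid[OF _ v] xreduced_h[of q "Suc b"] P_red_eq[OF lt q]
    by (simp add: xpoly_h_single)
qed

lemma P_red_replace:
  assumes "i < j" "j < k" "Poly_Mapping.keys (xmon i j 1 + xmon j k 1 + N) \<subseteq> arcs a b"
  shows "P_red (xmon i j 1 + xmon j k 1 + N) =
    P_red (xmon i k 1 + xmon i j 1 + N) + P_red (xmon i k 1 + xmon j k 1 + N)
      + beta * P_red (xmon i k 1 + N)"
proof (rule shift_fps_inj)
  have s: "Poly_Mapping.keys (xmon i k 1 + xmon i j 1 + N) \<subseteq> arcs a b"
    "Poly_Mapping.keys (xmon i k 1 + xmon j k 1 + N) \<subseteq> arcs a b"
    "Poly_Mapping.keys (xmon i k 1 + N) \<subseteq> arcs a b"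
    using assms by (auto simp: keys_add_nat arcs_def)
  have "valid_edges (Suc b) (Poly_Mapping.keys (xmon i j 1 + xmon j k 1 + N))"
    using assms(3) by (auto simp: valid_edges_def arcs_def)
  from mon_h_pair[OF assms(1,2) this]
  show "shift_fps (P_red (xmon i j 1 + xmon j k 1 + N)) = shift_fps
    (P_red (xmon i k 1 + xmon i j 1 + N) + P_red (xmon i k 1 + xmon j k 1 + N)
      + beta * P_red (xmon i k 1 + N))"
    unfolding shift_fps_add shift_fps_mult shift_fps_beta
      P_red_mon_h[OF assms(3)] s[THEN P_red_mon_h] .
qed

lemma P_red_reduced:
  assumes "Poly_Mapping.keys M \<subseteq> arcs a b"
    and "\<And>i j k. (i, j) \<in> Poly_Mapping.keys M \<Longrightarrow> (j, k) \<in> Poly_Mapping.keys M \<Longrightarrow> False"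
  shows "P_red M = 1"
proof -
  have "reduced_polynomial_of M (Poly_Mapping.single M 1)"
    using assms(2) by (auto simp: reduced_polynomial_of_def xreduced_def)
  then have "P_red M = xeval (\<lambda>_. 1) (Poly_Mapping.single M 1)"
    using assms(1) by (intro P_red_eq) (auto simp: arcs_def)
  then show ?thesis by (simp add: xeval_def)
qed

text \<open>
  The shifted value $P_M(z - 1)$. In statements about \<open>h_poly\<close> the polynomial \<open>beta\<close> is the
  indeterminate $z$, not $z - 1$.
\<close>

definition h_poly :: "xmonom \<Rightarrow> int poly"
  where "h_poly M = pcompose (P_red M) (beta - 1)"

lemma h_poly_replace:
  assumes "i < j" "j < k" "Poly_Mapping.keys (xmon i j 1 + xmon j k 1 + N) \<subseteq> arcs a b"
  shows "h_poly (xmon i j 1 + xmon j k 1 + N) =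
    h_poly (xmon i k 1 + xmon i j 1 + N) + h_poly (xmon i k 1 + xmon j k 1 + N)
      + (beta - 1) * h_poly (xmon i k 1 + N)"
proof -
  have "pcompose beta (beta - 1) = beta - 1" by (simp add: beta_def pcompose_pCons)
  then show ?thesis
    unfolding h_poly_def P_red_replace[OF assms] by (simp only: pcompose_add pcompose_mult)
qed

section \<open>The functional $\varphi$ and its relations\<close>

text \<open>
  The functional $\varphi$: the linear extension of \<open>h_poly\<close>. The coefficients of its
  argument are polynomials in $z$.
\<close>

definition h_lin :: "xpoly \<Rightarrow> int poly"
  where "h_lin p = (\<Sum>M \<in> Poly_Mapping.keys p. Poly_Mapping.lookup p M * h_poly M)"

lemma h_lin_add: "h_lin (p + q) = h_lin p + h_lin q"
  unfolding h_lin_def by (rule setsum_keys_plus_distrib) (auto simp: algebra_simps)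

lemma h_lin_0 [simp]: "h_lin 0 = 0"
  by (simp add: h_lin_def)

lemma h_lin_diff: "h_lin (p - q) = h_lin p - h_lin q"
  using h_lin_add[of "p - q" q] by simp

lemma h_lin_sum: "h_lin (sum f A) = (\<Sum>x\<in>A. h_lin (f x))"
  by (induction A rule: infinite_finite_induct) (auto simp: h_lin_add)

lemma h_lin_single: "h_lin (Poly_Mapping.single M c) = c * h_poly M"
  by (simp add: h_lin_def)

lemma xpoly_sum_singles:
  "(\<Sum>M\<in>Poly_Mapping.keys p. Poly_Mapping.single M (Poly_Mapping.lookup p M)) = p"
  by (rule poly_mapping_eqI)
    (auto simp: lookup_sum lookup_single when_def in_keys_iff)

lemma h_lin_xconst: "h_lin (xconst c * p) = c * h_lin p"
proof -
  have "h_lin (xconst c * p) = (\<Sum>M\<in>Poly_Mapping.keys p.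
      h_lin (xconst c * Poly_Mapping.single M (Poly_Mapping.lookup p M)))"
    by (subst (1) xpoly_sum_singles[symmetric]) (simp only: sum_distrib_left h_lin_sum)
  also have "\<dots> = c * h_lin p"
    by (simp only: xconst_def mult_single h_lin_single) (simp add: h_lin_def sum_distrib_left mult.assoc)
  finally show ?thesis .
qed

lemma xconst_add: "xconst (c + d) = xconst c + xconst d"
  and xconst_diff: "xconst (c - d) = xconst c - xconst d"
  and xconst_1 [simp]: "xconst 1 = 1"
  by (simp_all add: xconst_def single_add single_diff)

text \<open>
  The polynomials in the variables on the vertices $a, \dots, b$. The relations are only available
  for cofactors without variables $x_{ij}$ with $i \geq j$.
\<close>

definition on_arcs :: "nat \<Rightarrow> nat \<Rightarrow> xpoly set"
  where "on_arcs a b = {p. \<forall>M \<in> Poly_Mapping.keys p. Poly_Mapping.keys M \<subseteq> arcs a b}"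

lemma on_arcs_add: "p \<in> on_arcs a b \<Longrightarrow> q \<in> on_arcs a b \<Longrightarrow> p + q \<in> on_arcs a b"
  using keys_add[of p q] by (fastforce simp: on_arcs_def)

lemma on_arcs_diff: "p \<in> on_arcs a b \<Longrightarrow> q \<in> on_arcs a b \<Longrightarrow> p - q \<in> on_arcs a b"
  using keys_diff[of p q] by (fastforce simp: on_arcs_def)

lemma on_arcs_mult: "p \<in> on_arcs a b \<Longrightarrow> q \<in> on_arcs a b \<Longrightarrow> p * q \<in> on_arcs a b"
  using keys_mult[of p q] unfolding on_arcs_def
  by (force simp: keys_add_nat)

lemma on_arcs_xconst: "xconst c \<in> on_arcs a b"
  by (auto simp: on_arcs_def xconst_def)

lemma on_arcs_1: "1 \<in> on_arcs a b"
  using on_arcs_xconst[of 1] by simp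

lemma on_arcs_xvar: "(i, j) \<in> arcs a b \<Longrightarrow> xvar i j \<in> on_arcs a b"
  by (auto simp: on_arcs_def xvar_def)

lemma on_arcs_power: "p \<in> on_arcs a b \<Longrightarrow> p ^ m \<in> on_arcs a b"
  by (induction m) (auto intro: on_arcs_mult on_arcs_1)

lemma on_arcs_prod_mset:
  "(\<And>e. e \<in># M \<Longrightarrow> f e \<in> on_arcs a b) \<Longrightarrow> (\<Prod>e\<in>#M. f e) \<in> on_arcs a b"
  by (induction M) (auto intro: on_arcs_mult on_arcs_1)

lemma on_arcs_prod:
  "(\<And>e. e \<in> A \<Longrightarrow> f e \<in> on_arcs a b) \<Longrightarrow> (\<Prod>e\<in>A. f e) \<in> on_arcs a b"
  by (induction A rule: infinite_finite_induct) (auto intro: on_arcs_mult on_arcs_1)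

lemmas on_arcs_intros = on_arcs_add on_arcs_diff on_arcs_mult on_arcs_xconst on_arcs_1
  on_arcs_xvar on_arcs_power on_arcs_prod_mset on_arcs_prod

lemma arcs_trans: "(i, j) \<in> arcs a b \<Longrightarrow> (j, k) \<in> arcs a b \<Longrightarrow> (i, k) \<in> arcs a b"
  by (auto simp: arcs_def)

lemma h_lin_replace:
  assumes "(i, j) \<in> arcs a b" "(j, k) \<in> arcs a b" "p \<in> on_arcs a b"
  shows "h_lin (xvar i j * xvar j k * p) =
    h_lin (xvar i k * (xvar i j + xvar j k + xconst (beta - 1)) * p)"
proof -
  let ?l = "xvar i j * xvar j k" and ?r = "xvar i k * (xvar i j + xvar j k + xconst (beta - 1))"
  have "h_lin (?l * Poly_Mapping.single M c) = h_lin (?r * Poly_Mapping.single M c)"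
    if M: "M \<in> Poly_Mapping.keys p" for M c
  proof -
    have K: "Poly_Mapping.keys (xmon i j 1 + xmon j k 1 + M) \<subseteq> arcs a b"
      using assms M by (auto simp: keys_add_nat on_arcs_def)
    have "?r * Poly_Mapping.single M c = Poly_Mapping.single (xmon i k 1 + xmon i j 1 + M) c +
      Poly_Mapping.single (xmon i k 1 + xmon j k 1 + M) c +
      Poly_Mapping.single (xmon i k 1 + M) ((beta - 1) * c)"
      by (simp only: xvar_def xconst_def mult_single distrib_left distrib_right) (simp add: add_ac)
    moreover have "?l * Poly_Mapping.single M c = Poly_Mapping.single (xmon i j 1 + xmon j k 1 + M) c"
      by (simp add: xvar_def mult_single)
    moreover have "i < j" "j < k" using assms by (auto simp: arcs_def)
    ultimately show ?thesis
      by (simp only: h_lin_add h_lin_single h_poly_replace[OF _ _ K]) (simp add: algebra_simps)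
  qed
  then have "(\<Sum>M\<in>Poly_Mapping.keys p. h_lin (?l * Poly_Mapping.single M (Poly_Mapping.lookup p M))) =
     (\<Sum>M\<in>Poly_Mapping.keys p. h_lin (?r * Poly_Mapping.single M (Poly_Mapping.lookup p M)))"
    by (intro sum.cong) auto
  then show ?thesis
    by (simp only: h_lin_sum[symmetric] sum_distrib_left[symmetric] xpoly_sum_singles)
qed

text \<open>
  Two polynomials are equivalent if $\varphi$ does not distinguish their multiples by polynomials on
  the vertices $a, \dots, b$. This plays the role of equality modulo the ideal of the relations.
\<close>

definition h_equiv :: "nat \<Rightarrow> nat \<Rightarrow> xpoly \<Rightarrow> xpoly \<Rightarrow> bool"
  where "h_equiv a b p q \<longleftrightarrow> (\<forall>r \<in> on_arcs a b. h_lin (p * r) = h_lin (q * r))"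

lemma h_equiv_refl [simp]: "h_equiv a b p p" by (simp add: h_equiv_def)

lemma h_equiv_trans [trans]: "h_equiv a b p q \<Longrightarrow> h_equiv a b q r \<Longrightarrow> h_equiv a b p r"
  by (simp add: h_equiv_def)

lemma h_equiv_add: "h_equiv a b p q \<Longrightarrow> h_equiv a b p' q' \<Longrightarrow> h_equiv a b (p + p') (q + q')"
  by (simp add: h_equiv_def distrib_right h_lin_add)

lemma h_equiv_mult_right: "h_equiv a b p q \<Longrightarrow> r \<in> on_arcs a b \<Longrightarrow> h_equiv a b (p * r) (q * r)"
  by (simp add: h_equiv_def mult.assoc on_arcs_mult)

lemma h_equiv_mult_left: "h_equiv a b p q \<Longrightarrow> r \<in> on_arcs a b \<Longrightarrow> h_equiv a b (r * p) (r * q)"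
  using h_equiv_mult_right[of a b p q r] by (simp add: mult.commute)

lemma h_equiv_power:
  assumes "h_equiv a b p q" "p \<in> on_arcs a b" "q \<in> on_arcs a b"
  shows "h_equiv a b (p ^ m) (q ^ m)"
proof (induction m)
  case (Suc m)
  have "h_equiv a b (p * p ^ m) (q * p ^ m)"
    using assms by (intro h_equiv_mult_right on_arcs_intros)
  also have "h_equiv a b (q * p ^ m) (q * q ^ m)"
    using assms Suc by (intro h_equiv_mult_left)
  finally show ?case by simp
qed simp

lemma h_equiv_h_lin: "h_equiv a b p q \<Longrightarrow> h_lin p = h_lin q"
  unfolding h_equiv_def using on_arcs_1 by (metis mult.right_neutral)

text \<open>The variables $y_{ij} = x_{ij} - 1$ and $z_{ij} = y_{ij} + z = x_{ij} + (z - 1)$.\<close>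

definition yvar :: "nat \<times> nat \<Rightarrow> xpoly"
  where "yvar e = xvar (fst e) (snd e) - 1"

definition zvar :: "nat \<times> nat \<Rightarrow> xpoly"
  where "zvar e = yvar e + xconst beta"

lemma zvar_alt: "zvar (i, j) = xvar i j + xconst (beta - 1)"
  by (simp add: zvar_def yvar_def xconst_diff)

lemma on_arcs_yvar: "e \<in> arcs a b \<Longrightarrow> yvar e \<in> on_arcs a b"
  by (cases e) (auto simp: yvar_def intro!: on_arcs_intros)

lemma on_arcs_zvar: "e \<in> arcs a b \<Longrightarrow> zvar e \<in> on_arcs a b"
  by (auto simp: zvar_def intro!: on_arcs_intros on_arcs_yvar)

lemma xvar_replace:
  assumes "(i, j) \<in> arcs a b" "(j, k) \<in> arcs a b"
  shows "h_equiv a b (xvar i j * xvar j k) (xvar i k * (xvar i j + zvar (j, k)))"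
  using h_lin_replace[OF assms] by (simp add: h_equiv_def zvar_alt add_ac)

text \<open>
  The cofactor is the same as in \<open>xvar_replace\<close>; this is what makes \<open>path_factor\<close> work.
\<close>

lemma zvar_replace:
  assumes "(i, j) \<in> arcs a b" "(j, k) \<in> arcs a b"
  shows "h_equiv a b (zvar (i, j) * zvar (j, k)) (zvar (i, k) * (xvar i j + zvar (j, k)))"
proof -
  let ?c = "xconst (beta - 1)"
  have "zvar (i, j) * zvar (j, k) = xvar i j * xvar j k + ?c * (xvar i j + zvar (j, k))"
    by (simp add: zvar_alt algebra_simps)
  moreover have "zvar (i, k) * (xvar i j + zvar (j, k)) =
      xvar i k * (xvar i j + zvar (j, k)) + ?c * (xvar i j + zvar (j, k))"
    by (simp add: zvar_alt algebra_simps)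
  ultimately show ?thesis
    using h_equiv_add[OF xvar_replace[OF assms] h_equiv_refl] by metis
qed

lemma yvar_replace:
  assumes "(i, j) \<in> arcs a b" "(j, k) \<in> arcs a b"
  shows "h_equiv a b (yvar (i, j) * yvar (j, k))
    (yvar (i, k) * yvar (i, j) + yvar (i, k) * yvar (j, k) + xconst (1 + beta) * yvar (i, k) + xconst beta)"
proof -
  let ?u = "1 - xvar i j - xvar j k"
  have "yvar (i, j) * yvar (j, k) = xvar i j * xvar j k + ?u"
    by (simp add: yvar_def algebra_simps)
  moreover have "yvar (i, k) * yvar (i, j) + yvar (i, k) * yvar (j, k) + xconst (1 + beta) * yvar (i, k) + xconst beta
      = xvar i k * (xvar i j + zvar (j, k)) + ?u"
    by (simp add: yvar_def zvar_alt xconst_diff xconst_add algebra_simps)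
  ultimately show ?thesis
    using h_equiv_add[OF xvar_replace[OF assms] h_equiv_refl] by metis
qed

section \<open>Positivity and reversal\<close>

text \<open>$p$ and $q$ have degree at most $d$, and $q(z) = z^d p(1/z)$.\<close>

definition reverses :: "nat \<Rightarrow> int poly \<Rightarrow> int poly \<Rightarrow> bool"
  where "reverses d p q \<longleftrightarrow>
    (\<forall>i j. i + j = d \<longrightarrow> coeff p i = coeff q j) \<and> (\<forall>i>d. coeff p i = 0 \<and> coeff q i = 0)"

lemma reverses_sym: "reverses d p q \<Longrightarrow> reverses d q p"
  by (auto simp: reverses_def add.commute)

lemma reverses_add: "reverses d p q \<Longrightarrow> reverses d p' q' \<Longrightarrow> reverses d (p + p') (q + q')"
  by (simp add: reverses_def)

lemma coeff_beta_mult: "coeff (beta * p) i = (case i of 0 \<Rightarrow> 0 | Suc i' \<Rightarrow> coeff p i')"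
  by (simp add: beta_def coeff_pCons split: nat.split)

lemma beta_power: "beta ^ k = monom 1 k"
  by (simp add: beta_def monom_altdef)

lemma reverses_beta:
  assumes "reverses d p q"
  shows "reverses (Suc d) p (beta * q)"
proof -
  have "coeff p i = coeff (beta * q) j" if "i + j = Suc d" for i j
    using assms that by (cases j) (auto simp: reverses_def coeff_beta_mult)
  moreover have "coeff (beta * q) i = 0" if "i > Suc d" for i
    using assms that by (cases i) (auto simp: reverses_def coeff_beta_mult)
  ultimately show ?thesis using assms by (simp add: reverses_def)
qed

text \<open>
  The reversal identity makes $p$ symmetric with respect to degree $d - e$; since $p(0) \neq 0$, this
  is the degree of $p$.
\<close>

lemma symmetric_poly_if_reverses:
  assumes "reverses d p (beta ^ e * p)" "coeff p 0 \<noteq> 0"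
  shows "symmetric_poly p"
proof -
  have r: "coeff p i = coeff (monom 1 e * p) (d - i)" if "i \<le> d" for i
    using assms(1) that unfolding reverses_def beta_power by auto
  have e: "e \<le> d" using r[of 0] assms(2) by (auto simp: coeff_monom_mult split: if_splits)
  have c: "coeff p i = coeff p (d - e - i)" if "i \<le> d - e" for i
    using r[of i] e that by (auto simp: coeff_monom_mult add.commute)
  have z: "coeff p i = 0" if "i > d - e" for i
    using r[of i] that assms(1) by (cases "i \<le> d") (auto simp: coeff_monom_mult reverses_def)
  have "degree p = d - e"
    using c[of "d - e"] assms(2) z by (intro antisym degree_le le_degree) auto
  then show ?thesis using c by (simp add: symmetric_poly_def)
qed

abbreviation yprod :: "(nat \<times> nat) multiset \<Rightarrow> xpoly"
  where "yprod M \<equiv> (\<Prod>e\<in>#M. yvar e)"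

abbreviation xprod :: "(nat \<times> nat) multiset \<Rightarrow> xpoly"
  where "xprod M \<equiv> (\<Prod>(i, j)\<in>#M. xvar i j)"

text \<open>The monomial with the given multiset of variables.\<close>

definition mon :: "(nat \<times> nat) multiset \<Rightarrow> xmonom"
  where "mon M = (\<Sum>(i, j)\<in>#M. xmon i j 1)"

lemma mon_simps: "mon {#} = 0" "mon (add_mset (i, j) M) = xmon i j 1 + mon M"
  by (simp_all add: mon_def)

lemma xprod_single: "xprod M = Poly_Mapping.single (mon M) 1"
proof (induction M)
  case empty show ?case by (simp add: mon_simps)
next
  case (add e M)
  obtain i j where e: "e = (i, j)" by (cases e)
  have "xprod (add_mset e M) = xvar i j * xprod M" by (simp add: e)
  also have "\<dots> = Poly_Mapping.single (mon (add_mset e M)) 1"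
    unfolding add.IH by (simp add: xvar_def mult_single e mon_simps)
  finally show ?case .
qed

lemma keys_mon: "Poly_Mapping.keys (mon M) = set_mset M"
proof (induction M)
  case empty show ?case by (simp add: mon_simps)
next
  case (add e M)
  then show ?case by (cases e) (simp add: mon_simps keys_add_nat)
qed

lemma h_lin_reduced:
  assumes "set_mset M \<subseteq> arcs a b"
    and "\<And>i j k. (i, j) \<in># M \<Longrightarrow> (j, k) \<in># M \<Longrightarrow> False"
  shows "h_lin (xprod M) = 1"
proof -
  have "P_red (mon M) = 1"
    using assms by (intro P_red_reduced[where a = a and b = b], unfold keys_mon) blast+
  then show ?thesis
    unfolding xprod_single h_lin_single by (simp add: h_poly_def pcompose_1)
qed

text \<open>
  The factors $y_e = x_e - 1$ take differences of values of $\varphi$ on monomials without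
  replacements, and all these values are 1.
\<close>

lemma h_lin_yprod_reduced:
  assumes "set_mset M \<subseteq> arcs a b" "set_mset N \<subseteq> arcs a b"
    and "\<And>i j k. (i, j) \<in># M + N \<Longrightarrow> (j, k) \<in># M + N \<Longrightarrow> False"
  shows "h_lin (yprod M * xprod N) = (if M = {#} then 1 else 0)"
  using assms
proof (induction M arbitrary: N)
  case empty
  then have "h_lin (xprod N) = 1" by (intro h_lin_reduced[of N a b]) auto
  then show ?case by simp
next
  case (add e M)
  obtain i j where e: "e = (i, j)" by (cases e)
  have "yprod (add_mset e M) * xprod N = yprod M * xprod (add_mset e N) - yprod M * xprod N"
    by (simp add: e yvar_def algebra_simps)
  moreover have "h_lin (yprod M * xprod (add_mset e N)) = (if M = {#} then 1 else 0)"
    using add.prems by (intro add.IH) auto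
  moreover have "h_lin (yprod M * xprod N) = (if M = {#} then 1 else 0)"
    using add.prems by (intro add.IH) auto
  ultimately show ?case by (simp add: h_lin_diff)
qed

lemma yprod_nonneg_palindromic:
  assumes "set_mset M \<subseteq> arcs a b"
  shows "reverses (size M) (h_lin (yprod M)) (h_lin (yprod M)) \<and> (\<forall>i. coeff (h_lin (yprod M)) i \<ge> 0)"
  using assms
proof (induction "\<Sum>(i, j)\<in>#M. Suc b - (j - i)" arbitrary: M rule: less_induct)
  \<comment> \<open>The induction measure makes long arcs light, so that \<open>yvar_replace\<close> decreases it.\<close>
  case less
  show ?case
  proof (cases "\<exists>i j k. (i, j) \<in># M \<and> (j, k) \<in># M")
    case False
    then have "h_lin (yprod M) = (if M = {#} then 1 else 0)"
      using h_lin_yprod_reduced[of M a b "{#}"] less.prems by auto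
    then show ?thesis by (auto simp: reverses_def)
  next
    case True
    then obtain i j k where M: "(i, j) \<in># M" "(j, k) \<in># M" by blast
    with less.prems have arcs: "(i, j) \<in> arcs a b" "(j, k) \<in> arcs a b" by auto
    then have ik: "(i, k) \<in> arcs a b" by (rule arcs_trans)
    have lt: "i < j" "j < k" "k \<le> b" using arcs by (auto simp: arcs_def)
    define N where "N = M - {#(i, j)#} - {#(j, k)#}"
    have "(j, k) \<in># M - {#(i, j)#}" using M lt by (simp add: in_diff_count)
    then have "add_mset (j, k) N = M - {#(i, j)#}" unfolding N_def by (rule insert_DiffM)
    with M(1) have N: "M = {#(i, j), (j, k)#} + N" by simp
    have sub: "set_mset N \<subseteq> arcs a b" using less.prems N by auto
    let ?A = "{#(i, k), (i, j)#} + N" and ?B = "{#(i, k), (j, k)#} + N"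
      and ?C = "{#(i, k)#} + N"
    let ?h = "\<lambda>M. h_lin (yprod M)"
    have "h_equiv a b (yvar (i, j) * yvar (j, k))
      (yvar (i, k) * yvar (i, j) + yvar (i, k) * yvar (j, k) + xconst (1 + beta) * yvar (i, k) + xconst beta)"
      by (rule yvar_replace[OF arcs])
    moreover have "yprod N \<in> on_arcs a b"
      using sub by (intro on_arcs_prod_mset on_arcs_yvar) auto
    ultimately have "?h M = h_lin ((yvar (i, k) * yvar (i, j) + yvar (i, k) * yvar (j, k)
        + xconst (1 + beta) * yvar (i, k) + xconst beta) * yprod N)"
      by (simp add: N h_equiv_def mult.assoc)
    also have "\<dots> = ?h ?A + ?h ?B + (1 + beta) * ?h ?C + beta * ?h N"
      by (simp add: distrib_right h_lin_add h_lin_xconst mult.assoc)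
    finally have eq: "?h M = ?h ?A + ?h ?B + (?h ?C + beta * ?h ?C) + beta * ?h N"
      by (simp add: algebra_simps)
    have IH: "reverses (size K) (?h K) (?h K) \<and> (\<forall>i. coeff (?h K) i \<ge> 0)"
      if "K \<in> {?A, ?B, ?C, N}" for K
    proof (rule less.hyps)
      show "set_mset K \<subseteq> arcs a b" using that sub ik arcs by auto
      show "(\<Sum>(i, j)\<in>#K. Suc b - (j - i)) < (\<Sum>(i, j)\<in>#M. Suc b - (j - i))"
        using that lt by (auto simp: N)
    qed
    let ?n = "Suc (Suc (size N))"
    have "reverses ?n (?h ?A) (?h ?A)" "reverses ?n (?h ?B) (?h ?B)"
      using IH[of ?A] IH[of ?B] by simp_all
    moreover have "reverses ?n (?h ?C + beta * ?h ?C) (beta * ?h ?C + ?h ?C)"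
      using IH[of ?C] by (intro reverses_add reverses_sym[OF reverses_beta] reverses_beta) simp_all
    moreover have "reverses ?n (beta * ?h N) (beta * ?h N)"
      using IH[of N] by (intro reverses_beta reverses_sym[OF reverses_beta]) simp
    ultimately have "reverses ?n (?h M) (?h ?A + ?h ?B + (beta * ?h ?C + ?h ?C) + beta * ?h N)"
      unfolding eq by (rule reverses_add[OF reverses_add[OF reverses_add]])
    moreover have "?h ?A + ?h ?B + (beta * ?h ?C + ?h ?C) + beta * ?h N = ?h M"
      unfolding eq by (intro arg_cong2[where f = "(+)"] refl add.commute)
    ultimately have "reverses (size M) (?h M) (?h M)"
      by (simp only: N size_union size_add_mset size_empty add_Suc add_0)
    moreover have "coeff (?h M) l \<ge> 0" for l
    proof -
      have nn: "coeff (?h K) l' \<ge> 0" if "K \<in> {?A, ?B, ?C, N}" for K l'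
        using IH[OF that] by blast
      then have "coeff (beta * ?h K) l \<ge> 0" if "K \<in> {?A, ?B, ?C, N}" for K
        using that by (cases l) (simp_all only: coeff_beta_mult nat.case order_refl)
      with nn show ?thesis
        unfolding eq coeff_add by (intro add_nonneg_nonneg) blast+
    qed
    ultimately show ?thesis by blast
  qed
qed

text \<open>
  Expanding one factor $x_e = 1 + y_e$ on one side corresponds to expanding $z_e = z + y_e$ on the
  other, where the summand without $y_e$ has one factor fewer and hence acquires the factor $z$.
\<close>

lemma yprod_xprod_reverses:
  assumes "set_mset M \<subseteq> arcs a b" "set_mset N \<subseteq> arcs a b"
  shows "reverses (size M + size N) (h_lin (yprod M * xprod N)) (h_lin (yprod M * (\<Prod>e\<in>#N. zvar e)))
    \<and> (\<forall>i. coeff (h_lin (yprod M * xprod N)) i \<ge> coeff (h_lin (yprod M)) i)"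
  using assms
proof (induction N arbitrary: M)
  case empty
  then show ?case using yprod_nonneg_palindromic[of M a b] by simp
next
  case (add e N)
  let ?x = "\<lambda>M. h_lin (yprod M * xprod N)" and ?z = "\<lambda>M. h_lin (yprod M * (\<Prod>e\<in>#N. zvar e))"
  have sub: "set_mset (add_mset e M) \<subseteq> arcs a b" using add.prems by auto
  have "yprod M * xprod (add_mset e N) = yprod M * xprod N + yprod (add_mset e M) * xprod N"
    by (cases e) (simp add: yvar_def algebra_simps)
  then have x: "h_lin (yprod M * xprod (add_mset e N)) = ?x M + ?x (add_mset e M)"
    by (simp only: h_lin_add)
  have "yprod M * (\<Prod>e\<in>#add_mset e N. zvar e) =
      xconst beta * (yprod M * (\<Prod>e\<in>#N. zvar e)) + yprod (add_mset e M) * (\<Prod>e\<in>#N. zvar e)"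
    by (simp add: zvar_def algebra_simps)
  then have z: "h_lin (yprod M * (\<Prod>e\<in>#add_mset e N. zvar e)) = beta * ?z M + ?z (add_mset e M)"
    by (simp only: h_lin_add h_lin_xconst)
  have IH: "reverses (size M + size N) (?x M) (?z M)" "\<And>i. coeff (?x M) i \<ge> coeff (h_lin (yprod M)) i"
    using add.IH[of M] add.prems by auto
  have IH': "reverses (size (add_mset e M) + size N) (?x (add_mset e M)) (?z (add_mset e M))"
    "\<And>i. coeff (?x (add_mset e M)) i \<ge> coeff (h_lin (yprod (add_mset e M))) i"
    using add.IH[OF sub] add.prems by auto
  have "reverses (size M + size (add_mset e N)) (?x M + ?x (add_mset e M)) (beta * ?z M + ?z (add_mset e M))"
    using reverses_beta[OF IH(1)] IH'(1) by (intro reverses_add) simp_all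
  moreover have "coeff (?x M + ?x (add_mset e M)) i \<ge> coeff (h_lin (yprod M)) i" for i
    using IH(2)[of i] IH'(2)[of i] yprod_nonneg_palindromic[OF sub] by (simp del: image_mset_add_mset) (smt (verit))
  ultimately show ?case unfolding x z by blast
qed

section \<open>Symmetry for paths\<close>

text \<open>On the vertices $a, \dots, b$ no replacement involves $x_{ab}$.\<close>

lemma P_red_outer_arc:
  assumes "a < b" "Poly_Mapping.keys M \<subseteq> arcs a b"
  shows "P_red (xmon a b 1 + M) = P_red M"
  using assms(2)
proof (induction "mon_weight (Suc b) M" arbitrary: M rule: less_induct)
  case less
  have ab: "Poly_Mapping.keys (xmon a b 1 + K) \<subseteq> arcs a b" if "Poly_Mapping.keys K \<subseteq> arcs a b" for K
    using that assms(1) by (auto simp: keys_add_nat arcs_def)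
  show ?case
  proof (cases "\<exists>i j k. (i, j) \<in> Poly_Mapping.keys M \<and> (j, k) \<in> Poly_Mapping.keys M")
    case False
    have "P_red M = 1" using False less.prems by (intro P_red_reduced) auto
    moreover have "P_red (xmon a b 1 + M) = 1"
      using False less.prems assms(1)
      by (intro P_red_reduced[OF ab[OF less.prems]]) (auto simp: keys_add_nat arcs_def)
    ultimately show ?thesis by simp
  next
    case True
    then obtain i j k where M: "(i, j) \<in> Poly_Mapping.keys M" "(j, k) \<in> Poly_Mapping.keys M" by blast
    with less.prems have lt: "a \<le> i" "i < j" "j < k" "k \<le> b" by (auto simp: arcs_def)
    define N where "N = M - (xmon i j 1 + xmon j k 1)"
    have eq: "M = xmon i j 1 + xmon j k 1 + N"
      unfolding N_def using M lt by (intro poly_mapping_eqI)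
        (auto simp: lookup_add lookup_minus xmon_def lookup_single when_def in_keys_iff)
    have K: "Poly_Mapping.keys (xmon i j 1 + xmon j k 1 + N) \<subseteq> arcs a b"
      using less.prems eq by simp
    have IH: "P_red (xmon a b 1 + K) = P_red K"
      if "K \<in> {xmon i k 1 + xmon i j 1 + N, xmon i k 1 + xmon j k 1 + N, xmon i k 1 + N}" for K
    proof (rule less.hyps)
      show "mon_weight (Suc b) K < mon_weight (Suc b) M"
        using that lt unfolding eq by (auto simp: mon_weight_add mon_weight_xmon[unfolded One_nat_def])
      show "Poly_Mapping.keys K \<subseteq> arcs a b"
        using that K lt by (auto simp: keys_add_nat arcs_def)
    qed
    have sh: "xmon a b 1 + (p + q + N) = p + q + (xmon a b 1 + N)"
      "xmon a b 1 + (p + N) = p + (xmon a b 1 + N)" for p q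
      by (simp_all add: add_ac)
    have K': "Poly_Mapping.keys (xmon i j 1 + xmon j k 1 + (xmon a b 1 + N)) \<subseteq> arcs a b"
      using ab[OF K] by (simp only: sh)
    show ?thesis
      unfolding eq sh P_red_replace[OF lt(2,3) K'] P_red_replace[OF lt(2,3) K]
      using IH[of "xmon i k 1 + xmon i j 1 + N", unfolded sh]
        IH[of "xmon i k 1 + xmon j k 1 + N", unfolded sh] IH[of "xmon i k 1 + N", unfolded sh]
      by simp
  qed
qed

lemma h_lin_outer_arc:
  assumes "a < b" "p \<in> on_arcs a b"
  shows "h_lin (xvar a b * p) = h_lin p"
proof -
  have "h_lin (xvar a b * p) = (\<Sum>M\<in>Poly_Mapping.keys p.
      h_lin (xvar a b * Poly_Mapping.single M (Poly_Mapping.lookup p M)))"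
    by (subst (1) xpoly_sum_singles[symmetric]) (simp only: sum_distrib_left h_lin_sum)
  also have "\<dots> = h_lin p"
    unfolding h_lin_def[of p]
  proof (rule sum.cong)
    fix M assume "M \<in> Poly_Mapping.keys p"
    then have "Poly_Mapping.keys M \<subseteq> arcs a b" using assms(2) by (auto simp: on_arcs_def)
    from P_red_outer_arc[OF assms(1) this]
    show "h_lin (xvar a b * Poly_Mapping.single M (Poly_Mapping.lookup p M)) =
        Poly_Mapping.lookup p M * h_poly M"
      by (simp add: xvar_def mult_single h_lin_single h_poly_def)
  qed simp
  finally show ?thesis .
qed

lemma h_lin_outer_arc_power:
  assumes "a < b" "p \<in> on_arcs a b"
  shows "h_lin (xvar a b ^ m * p) = h_lin p"
    and "h_lin (zvar (a, b) ^ m * p) = beta ^ m * h_lin p"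
proof -
  have ab: "(a, b) \<in> arcs a b" using assms(1) by (simp add: arcs_def)
  show "h_lin (xvar a b ^ m * p) = h_lin p"
  proof (induction m)
    case (Suc m)
    have "xvar a b ^ m * p \<in> on_arcs a b" using assms(2) ab by (intro on_arcs_intros)
    from h_lin_outer_arc[OF assms(1) this] show ?case using Suc by (simp add: mult.assoc)
  qed simp
  show "h_lin (zvar (a, b) ^ m * p) = beta ^ m * h_lin p"
  proof (induction m)
    case (Suc m)
    have "zvar (a, b) ^ m * p \<in> on_arcs a b"
      using assms(2) ab by (intro on_arcs_mult on_arcs_power on_arcs_zvar)
    from h_lin_outer_arc[OF assms(1) this] show ?case using Suc
      by (simp add: mult.assoc zvar_alt distrib_right h_lin_add h_lin_xconst) (simp add: algebra_simps)
  qed simp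
qed

text \<open>
  The cofactor $Q$ is the product of the factors $x_{al} + z_{l,l+1}$ for $a < l < c$; what matters is
  that it is the same for both products.
\<close>

lemma path_factor:
  assumes "a < c" "c \<le> b"
  shows "\<exists>Q \<in> on_arcs a b. h_equiv a b (\<Prod>l\<in>{a..<c}. xvar l (l + 1)) (xvar a c * Q)
    \<and> h_equiv a b (\<Prod>l\<in>{a..<c}. zvar (l, l + 1)) (zvar (a, c) * Q)"
  using assms
proof (induction c)
  case 0
  then show ?case by simp
next
  case (Suc c)
  then have "a \<le> c" by simp
  show ?case
  proof (cases "c = a")
    case True
    then show ?thesis using on_arcs_1 by (intro bexI[of _ 1]) simp_all
  next
    case False
    then have arcs: "(a, c) \<in> arcs a b" "(c, c + 1) \<in> arcs a b"
      using Suc.prems by (auto simp: arcs_def)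
    obtain Q where Q: "Q \<in> on_arcs a b"
      "h_equiv a b (\<Prod>l\<in>{a..<c}. xvar l (l + 1)) (xvar a c * Q)"
      "h_equiv a b (\<Prod>l\<in>{a..<c}. zvar (l, l + 1)) (zvar (a, c) * Q)"
      using Suc False by auto
    let ?Q = "(xvar a c + zvar (c, c + 1)) * Q"
    have "h_equiv a b ((\<Prod>l\<in>{a..<c}. xvar l (l + 1)) * xvar c (c + 1)) (xvar a c * Q * xvar c (c + 1))"
      using Q(2) arcs by (intro h_equiv_mult_right on_arcs_xvar)
    also have "xvar a c * Q * xvar c (c + 1) = xvar a c * xvar c (c + 1) * Q" by (simp add: mult_ac)
    also have "h_equiv a b \<dots> (xvar a (c + 1) * (xvar a c + zvar (c, c + 1)) * Q)"
      using Q(1) xvar_replace[OF arcs] by (rule h_equiv_mult_right[rotated])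
    finally have x: "h_equiv a b (\<Prod>l\<in>{a..<Suc c}. xvar l (l + 1)) (xvar a (c + 1) * ?Q)"
      using \<open>a \<le> c\<close> by (simp add: mult.assoc)
    have "h_equiv a b ((\<Prod>l\<in>{a..<c}. zvar (l, l + 1)) * zvar (c, c + 1)) (zvar (a, c) * Q * zvar (c, c + 1))"
      using Q(3) arcs by (intro h_equiv_mult_right on_arcs_zvar)
    also have "zvar (a, c) * Q * zvar (c, c + 1) = zvar (a, c) * zvar (c, c + 1) * Q" by (simp add: mult_ac)
    also have "h_equiv a b \<dots> (zvar (a, c + 1) * (xvar a c + zvar (c, c + 1)) * Q)"
      using Q(1) zvar_replace[OF arcs] by (rule h_equiv_mult_right[rotated])
    finally have z: "h_equiv a b (\<Prod>l\<in>{a..<Suc c}. zvar (l, l + 1)) (zvar (a, c + 1) * ?Q)"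
      using \<open>a \<le> c\<close> by (simp add: mult.assoc)
    have "?Q \<in> on_arcs a b" using Q(1) arcs by (intro on_arcs_intros on_arcs_zvar)
    then show ?thesis using x z by (intro bexI[of _ ?Q]) simp_all
  qed
qed

lemma path_power_z:
  assumes "a < b"
  shows "h_lin ((\<Prod>l\<in>{a..<b}. zvar (l, l + 1)) ^ m) = beta ^ m * h_lin ((\<Prod>l\<in>{a..<b}. xvar l (l + 1)) ^ m)"
proof -
  obtain Q where Q: "Q \<in> on_arcs a b"
      "h_equiv a b (\<Prod>l\<in>{a..<b}. xvar l (l + 1)) (xvar a b * Q)"
      "h_equiv a b (\<Prod>l\<in>{a..<b}. zvar (l, l + 1)) (zvar (a, b) * Q)"
    using path_factor[OF assms order_refl] by blast
  have ab: "(a, b) \<in> arcs a b" using assms by (simp add: arcs_def)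
  have Qm: "Q ^ m \<in> on_arcs a b" using Q(1) by (rule on_arcs_power)
  have l: "(l, l + 1) \<in> arcs a b" if "l \<in> {a..<b}" for l using that by (auto simp: arcs_def)
  have "h_lin ((\<Prod>l\<in>{a..<b}. zvar (l, l + 1)) ^ m) = h_lin ((zvar (a, b) * Q) ^ m)"
    using Q ab l by (intro h_equiv_h_lin[OF h_equiv_power] on_arcs_mult on_arcs_prod on_arcs_zvar)
  also have "\<dots> = beta ^ m * h_lin (Q ^ m)"
    by (simp add: power_mult_distrib h_lin_outer_arc_power(2)[OF assms Qm])
  also have "h_lin (Q ^ m) = h_lin ((xvar a b * Q) ^ m)"
    by (simp add: power_mult_distrib h_lin_outer_arc_power(1)[OF assms Qm])
  also have "\<dots> = h_lin ((\<Prod>l\<in>{a..<b}. xvar l (l + 1)) ^ m)"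
    using Q ab l by (intro h_equiv_h_lin[OF h_equiv_power, symmetric] on_arcs_intros)
  finally show ?thesis .
qed

lemma xvar_power: "xvar i j ^ m = Poly_Mapping.single (xmon i j m) 1"
proof (induction m)
  case 0
  then show ?case by (simp add: xmon_def)
next
  case (Suc m)
  then show ?case by (simp add: xvar_def mult_single xmon_def single_add[symmetric])
qed

lemma h_poly_path:
  "h_poly (\<Sum>l\<in>A. xmon l (l + 1) m) = h_lin ((\<Prod>l\<in>A. xvar l (l + 1)) ^ m)"
proof -
  have "Poly_Mapping.single (\<Sum>l\<in>A. xmon l (l + 1) m) (1 :: int poly) = (\<Prod>l\<in>A. xvar l (l + 1) ^ m)"
  proof (induction A rule: infinite_finite_induct)
    case (insert l A)
    show ?case
      unfolding sum.insert[OF insert(1,2)] prod.insert[OF insert(1,2)] insert(3)[symmetric]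
      by (simp add: xvar_power mult_single)
  qed simp_all
  then have "h_lin (Poly_Mapping.single (\<Sum>l\<in>A. xmon l (l + 1) m) 1) =
      h_lin ((\<Prod>l\<in>A. xvar l (l + 1)) ^ m)"
    by (simp only: prod_power_distrib)
  then show ?thesis by (simp only: h_lin_single mult_1)
qed

lemma h_poly_0: "h_poly 0 = 1"
  using P_red_reduced[of 0 0 0] by (simp add: h_poly_def pcompose_1)

theorem h_poly_path_symmetric_nonneg:
  fixes n m :: nat
  defines "p \<equiv> h_poly (\<Sum>l\<in>{1..<n}. xmon l (l + 1) m)"
  shows "symmetric_poly p \<and> (\<forall>i. coeff p i \<ge> 0)"
proof (cases "n \<le> 1")
  case True
  then have "p = 1" by (simp add: p_def h_poly_0)
  then show ?thesis by (auto simp: symmetric_poly_def)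
next
  case False
  \<comment> \<open>the multiset of the variables of $(x_{12} x_{23} \cdots x_{n-1,n})^m$\<close>
  define N where "N = (\<Sum>l\<in>{1..<n}. replicate_mset m (l, l + 1))"
  have prod_N: "(\<Prod>e\<in>#N. f e) = (\<Prod>l\<in>{1..<n}. f (l, l + 1)) ^ m" for f :: "_ \<Rightarrow> xpoly"
  proof -
    have "(\<Prod>e\<in>#(\<Sum>l\<in>A. replicate_mset m (l, l + 1)). f e) = (\<Prod>l\<in>A. f (l, l + 1) ^ m)" for A :: "nat set"
      by (induction A rule: infinite_finite_induct) simp_all
    then show ?thesis by (simp add: N_def prod_power_distrib)
  qed
  have sub: "set_mset N \<subseteq> arcs 1 n"
    by (auto simp: N_def set_mset_sum arcs_def split: if_splits)
  have p: "h_lin (xprod N) = p"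
    unfolding p_def h_poly_path prod_N by simp
  have "h_lin (\<Prod>e\<in>#N. zvar e) = beta ^ m * p"
    using False unfolding prod_N p_def h_poly_path by (intro path_power_z) simp
  then have *: "reverses (size N) p (beta ^ m * p)" "\<And>i. coeff p i \<ge> coeff (h_lin 1) i"
    using yprod_xprod_reverses[of "{#}" 1 n N] sub by (auto simp: p)
  \<comment> \<open>the second part of * bounds the constant coefficient of $p$ from below by 1\<close>
  have "h_lin 1 = 1" using h_lin_reduced[of "{#}"] by simp
  with *(2) have c: "coeff p i \<ge> coeff 1 i" for i by simp
  have "coeff p 0 \<noteq> 0" using c[of 0] by simp
  then have "symmetric_poly p" by (rule symmetric_poly_if_reverses[OF *(1)])
  moreover have "coeff p i \<ge> 0" for i by (rule order_trans[OF _ c]) simp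
  ultimately show ?thesis by blast
qed

section \<open>The Delannoy recursion\<close>

text \<open>Two-index families with boundary values 1 that satisfy the weighted Delannoy recursion.\<close>

definition delannoy_rec :: "(nat \<Rightarrow> nat \<Rightarrow> int poly) \<Rightarrow> bool"
  where "delannoy_rec f \<longleftrightarrow> (\<forall>n. f n 0 = 1) \<and> (\<forall>m. f 0 m = 1)
    \<and> (\<forall>n m. f (Suc n) (Suc m) = f (Suc n) m + f n (Suc m) + beta * f n m)"

lemma delannoy_rec_unique:
  assumes "delannoy_rec f" "delannoy_rec g"
  shows "f n m = g n m"
proof (induction n arbitrary: m)
  case 0
  then show ?case using assms by (simp add: delannoy_rec_def)
next
  case (Suc n)
  show ?case using assms Suc by (induction m) (simp_all add: delannoy_rec_def)
qed

lemma xmon_Suc: "xmon i j (Suc n) = xmon i j 1 + xmon i j n"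
  by (simp add: xmon_def single_add[symmetric])

lemma delannoy_rec_P_red: "delannoy_rec (\<lambda>n m. P_red (xmon 1 2 n + xmon 2 3 m))"
  unfolding delannoy_rec_def
proof (intro conjI allI)
  let ?M = "\<lambda>n m. xmon 1 2 n + xmon 2 3 m"
  have keys: "Poly_Mapping.keys (?M n m) = (if n = 0 then {} else {(1, 2)}) \<union> (if m = 0 then {} else {(2, 3)})"
    for n m by (simp add: keys_add_nat xmon_def)
  have sub: "Poly_Mapping.keys (?M n m) \<subseteq> arcs 1 3" for n m
    unfolding keys by (auto simp: arcs_def)
  show "P_red (?M n 0) = 1" for n
    by (rule P_red_reduced[OF sub], unfold keys) (auto split: if_splits)
  show "P_red (?M 0 m) = 1" for m
    by (rule P_red_reduced[OF sub], unfold keys) (auto split: if_splits)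
  fix n m
  have M: "?M (Suc n) (Suc m) = xmon 1 2 1 + xmon 2 3 1 + ?M n m"
    "?M (Suc n) m = xmon 1 2 1 + ?M n m" "?M n (Suc m) = xmon 2 3 1 + ?M n m"
    by (simp_all only: xmon_Suc add_ac)
  have "P_red (xmon 1 2 1 + xmon 2 3 1 + ?M n m) =
    P_red (xmon 1 3 1 + xmon 1 2 1 + ?M n m) + P_red (xmon 1 3 1 + xmon 2 3 1 + ?M n m)
      + beta * P_red (xmon 1 3 1 + ?M n m)"
    by (rule P_red_replace) (use sub[of "Suc n" "Suc m"] M(1) in auto)
  also have "P_red (xmon 1 3 1 + xmon 1 2 1 + ?M n m) = P_red (?M (Suc n) m)"
    unfolding M(2) add.assoc by (rule P_red_outer_arc) (use sub[of "Suc n" m] M(2) in auto)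
  also have "P_red (xmon 1 3 1 + xmon 2 3 1 + ?M n m) = P_red (?M n (Suc m))"
    unfolding M(3) add.assoc by (rule P_red_outer_arc) (use sub[of n "Suc m"] M(3) in auto)
  also have "P_red (xmon 1 3 1 + ?M n m) = P_red (?M n m)"
    by (rule P_red_outer_arc) (use sub in auto)
  finally show "P_red (?M (Suc n) (Suc m)) =
      P_red (?M (Suc n) m) + P_red (?M n (Suc m)) + beta * P_red (?M n m)"
    unfolding M(1) .
qed

lemma coeff_sum_beta:
  assumes "\<And>k. k > N \<Longrightarrow> c k = 0"
  shows "coeff (\<Sum>k\<le>N. of_nat (c k) * beta ^ k) i = int (c i)"
proof -
  have "coeff (\<Sum>k\<le>N. of_nat (c k) * beta ^ k) i = (\<Sum>k\<le>N. if k = i then int (c k) else 0)"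
    unfolding coeff_sum by (intro sum.cong) (auto simp: beta_power of_nat_poly coeff_monom_mult)
  also have "\<dots> = int (c i)" using assms[of i] by simp
  finally show ?thesis .
qed

lemma delannoy_rec_multinomial:
  "delannoy_rec (\<lambda>n m. \<Sum>k\<le>min n m. of_nat (((n + m - k) choose m) * (m choose k)) * beta ^ k)"
proof -
  let ?c = "\<lambda>n m k. ((n + m - k) choose m) * (m choose k)"
  let ?F = "\<lambda>n m. \<Sum>k\<le>min n m. of_nat (?c n m k) * beta ^ k"
  have coeff: "coeff (?F n m) k = int (?c n m k)" for n m k
  proof (rule coeff_sum_beta)
    fix k assume "k > min n m"
    then show "?c n m k = 0" by (cases "m < k") auto
  qed
  have rec: "?c (Suc n) (Suc m) (Suc k) = ?c (Suc n) m (Suc k) + ?c n (Suc m) (Suc k) + ?c n m k" for n m k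
  proof (cases "k \<le> n + m")
    case True
    then have "Suc n + Suc m - Suc k = Suc (n + m - k)" "Suc n + m - Suc k = n + m - k"
      "n + Suc m - Suc k = n + m - k" by auto
    then show ?thesis by (simp add: algebra_simps)
  next
    \<comment> \<open>The subtraction is truncated here, but all terms vanish because $m < k$.\<close>
    case False
    then show ?thesis by (simp add: binomial_eq_0)
  qed
  have "?F (Suc n) (Suc m) = ?F (Suc n) m + ?F n (Suc m) + beta * ?F n m" for n m
  proof (rule poly_eqI)
    fix k
    show "coeff (?F (Suc n) (Suc m)) k = coeff (?F (Suc n) m + ?F n (Suc m) + beta * ?F n m) k"
    proof (cases k)
      case 0
      then show ?thesis unfolding coeff_add coeff_beta_mult coeff by simp
    next
      case (Suc k')
      then show ?thesis unfolding coeff_add coeff_beta_mult coeff Suc nat.case rec by simp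
    qed
  qed
  then show ?thesis unfolding delannoy_rec_def by simp
qed

text \<open>
  The sums with $z$ in place of $1 + \beta$ satisfy
  $F_{n+1,m+1} + F_{n,m} = F_{n+1,m} + F_{n,m+1} + z F_{n,m}$, which is compared coefficientwise
  before $z = 1 + \beta$ is substituted.
\<close>

lemma delannoy_rec_shifted:
  "delannoy_rec (\<lambda>n m. \<Sum>k\<le>min n m. of_nat ((n choose k) * (m choose k)) * (1 + beta) ^ k)"
proof -
  let ?c = "\<lambda>n m k. (n choose k) * (m choose k)"
  let ?F = "\<lambda>n m. \<Sum>k\<le>min n m. of_nat (?c n m k) * beta ^ k"
  let ?G = "\<lambda>n m. \<Sum>k\<le>min n m. of_nat (?c n m k) * (1 + beta) ^ k"
  have G: "?G n m = pcompose (?F n m) (1 + beta)" for n m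
  proof -
    have "pcompose (beta ^ k) (1 + beta) = (1 + beta) ^ k" for k
      by (induction k) (simp_all add: pcompose_1 pcompose_mult, simp add: beta_def pcompose_pCons)
    then show ?thesis by (simp add: pcompose_sum pcompose_smult of_nat_poly del: of_nat_mult)
  qed
  have coeff: "coeff (?F n m) k = int (?c n m k)" for n m k
    by (rule coeff_sum_beta) (auto simp: min_less_iff_disj)
  have "?F (Suc n) (Suc m) + ?F n m = ?F (Suc n) m + ?F n (Suc m) + beta * ?F n m" for n m
  proof (rule poly_eqI)
    fix k
    show "coeff (?F (Suc n) (Suc m) + ?F n m) k =
        coeff (?F (Suc n) m + ?F n (Suc m) + beta * ?F n m) k"
    proof (cases k)
      case 0
      then show ?thesis unfolding coeff_add coeff_beta_mult coeff by simp
    next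
      case (Suc k')
      then show ?thesis unfolding coeff_add coeff_beta_mult coeff Suc nat.case
        by (simp add: algebra_simps)
    qed
  qed
  then have "pcompose (?F (Suc n) (Suc m) + ?F n m) (1 + beta) =
      pcompose (?F (Suc n) m + ?F n (Suc m) + beta * ?F n m) (1 + beta)" for n m
    by (rule arg_cong)
  moreover have "pcompose beta (1 + beta) = 1 + beta" by (simp add: beta_def pcompose_pCons)
  ultimately have "?G (Suc n) (Suc m) = ?G (Suc n) m + ?G n (Suc m) + beta * ?G n m" for n m
    unfolding pcompose_add pcompose_mult G[symmetric] by (simp add: distrib_right)
  then show ?thesis unfolding delannoy_rec_def by simp
qed

lemma delannoy_paths_rec:
  "delannoy_paths n 0 = {replicate n StepE}"
  "delannoy_paths 0 m = {replicate m StepN}"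
  "delannoy_paths (Suc n) (Suc m) = Cons StepN ` delannoy_paths (Suc n) m
    \<union> (Cons StepE ` delannoy_paths n (Suc m) \<union> Cons StepNE ` delannoy_paths n m)"
proof -
  have nil: "[] \<in> delannoy_paths n m \<longleftrightarrow> n = 0 \<and> m = 0" for n m
    by (auto simp: delannoy_paths_def zero_prod_def)
  have cons: "StepE # w \<in> delannoy_paths n m \<longleftrightarrow> (\<exists>n'. n = Suc n' \<and> w \<in> delannoy_paths n' m)"
    "StepN # w \<in> delannoy_paths n m \<longleftrightarrow> (\<exists>m'. m = Suc m' \<and> w \<in> delannoy_paths n m')"
    "StepNE # w \<in> delannoy_paths n m \<longleftrightarrow> (\<exists>n' m'. n = Suc n' \<and> m = Suc m' \<and> w \<in> delannoy_paths n' m')"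
    for w n m
    by (cases "sum_list (map step_vec w)"; auto simp: delannoy_paths_def)+
  have row: "w \<in> delannoy_paths n 0 \<longleftrightarrow> w = replicate n StepE" for w n
  proof (induction w arbitrary: n)
    case Nil
    then show ?case by (cases n) (simp_all add: nil)
  next
    case (Cons s w)
    then show ?case by (cases s; cases n) (auto simp: cons)
  qed
  have col: "w \<in> delannoy_paths 0 m \<longleftrightarrow> w = replicate m StepN" for w m
  proof (induction w arbitrary: m)
    case Nil
    then show ?case by (cases m) (simp_all add: nil)
  next
    case (Cons s w)
    then show ?case by (cases s; cases m) (auto simp: cons)
  qed
  show "delannoy_paths n 0 = {replicate n StepE}" "delannoy_paths 0 m = {replicate m StepN}"
    using row col by blast+
  have "w \<in> delannoy_paths (Suc n) (Suc m) \<longleftrightarrow> w \<in> Cons StepN ` delannoy_paths (Suc n) m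
    \<union> (Cons StepE ` delannoy_paths n (Suc m) \<union> Cons StepNE ` delannoy_paths n m)" for w
  proof (cases w)
    case Nil
    then show ?thesis by (auto simp: nil)
  next
    case (Cons s v)
    then show ?thesis by (cases s) (auto simp: cons)
  qed
  then show "delannoy_paths (Suc n) (Suc m) = Cons StepN ` delannoy_paths (Suc n) m
    \<union> (Cons StepE ` delannoy_paths n (Suc m) \<union> Cons StepNE ` delannoy_paths n m)"
    by blast
qed

text \<open>The generating polynomial of the $(n,m)$-Delannoy paths by the number of $NE$ steps.\<close>

definition delannoy_poly :: "nat \<Rightarrow> nat \<Rightarrow> int poly"
  where "delannoy_poly n m = (\<Sum>w \<in> delannoy_paths n m. beta ^ count_list w StepNE)"

lemma finite_delannoy_paths: "finite (delannoy_paths n m)"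
proof (induction n arbitrary: m)
  case (Suc n)
  then show ?case by (induction m) (simp_all add: delannoy_paths_rec)
qed (simp add: delannoy_paths_rec)

lemma delannoy_rec_paths: "delannoy_rec delannoy_poly"
proof -
  have fin: "finite (Cons s ` delannoy_paths n m)" for s n m
    using finite_delannoy_paths by (rule finite_imageI)
  have Cons: "(\<Sum>w \<in> Cons s ` delannoy_paths n m. beta ^ count_list w StepNE)
      = (if s = StepNE then beta else 1) * delannoy_poly n m" for s n m
    by (simp add: sum.reindex delannoy_poly_def sum_distrib_left)
  have "delannoy_poly (Suc n) (Suc m) =
      delannoy_poly (Suc n) m + delannoy_poly n (Suc m) + beta * delannoy_poly n m" for n m
  proof -
    have "delannoy_poly (Suc n) (Suc m) =
      (\<Sum>w \<in> Cons StepN ` delannoy_paths (Suc n) m. beta ^ count_list w StepNE) +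
      ((\<Sum>w \<in> Cons StepE ` delannoy_paths n (Suc m). beta ^ count_list w StepNE) +
       (\<Sum>w \<in> Cons StepNE ` delannoy_paths n m. beta ^ count_list w StepNE))"
      unfolding delannoy_poly_def[of "Suc n" "Suc m"] delannoy_paths_rec(3)
      by (subst sum.union_disjoint, use fin in auto)+
    then show ?thesis unfolding Cons by (simp add: add.assoc)
  qed
  moreover have "delannoy_poly n 0 = 1" "delannoy_poly 0 m = 1" for n m
    by (simp_all add: delannoy_poly_def delannoy_paths_rec(1,2) count_list_0_iff)
  ultimately show ?thesis by (simp add: delannoy_rec_def)
qed

lemma coeff_delannoy_poly:
  "coeff (delannoy_poly n m) k = int (card {w \<in> delannoy_paths n m. count_list w StepNE = k})"
proof -
  have "coeff (delannoy_poly n m) k = (\<Sum>w \<in> delannoy_paths n m. if count_list w StepNE = k then 1 else 0)"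
    unfolding delannoy_poly_def coeff_sum beta_power by simp
  also have "\<dots> = (\<Sum>w \<in> {w \<in> delannoy_paths n m. count_list w StepNE = k}. 1)"
    by (rule sum.inter_filter[OF finite_delannoy_paths, symmetric])
  finally show ?thesis by simp
qed

theorem lemma5p3:
  fixes n m :: nat
  shows
    "P_red (xmon 1 2 n + xmon 2 3 m)
       = (\<Sum>k\<le>min n m. of_nat (((n + m - k) choose m) * (m choose k)) * beta ^ k)
     \<and> (\<Sum>k\<le>min n m. of_nat (((n + m - k) choose m) * (m choose k)) * beta ^ k)
       = (\<Sum>k\<le>min n m. of_nat ((n choose k) * (m choose k)) * (1 + beta) ^ k)
     \<and> (symmetric_poly (pcompose (P_red (\<Sum>i\<in>{1..<n}. xmon i (i + 1) m)) (beta - 1))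
        \<and> (\<forall>i. coeff (pcompose (P_red (\<Sum>i\<in>{1..<n}. xmon i (i + 1) m)) (beta - 1)) i \<ge> 0))
     \<and> (\<forall>k. coeff (P_red (xmon 1 2 n + xmon 2 3 m)) k
            = int (card {w \<in> delannoy_paths n m. count_list w StepNE = k}))"
  (is "?P = ?S \<and> ?S = ?T \<and> ?sym \<and> ?paths")
proof (intro conjI)
  show "?P = ?S"
    using delannoy_rec_P_red delannoy_rec_multinomial by (rule delannoy_rec_unique)
  show "?S = ?T"
    using delannoy_rec_multinomial delannoy_rec_shifted by (rule delannoy_rec_unique)
  show ?paths
    unfolding coeff_delannoy_poly[symmetric]
    using delannoy_rec_unique[OF delannoy_rec_P_red delannoy_rec_paths] by simp
next
  note sym = h_poly_path_symmetric_nonneg[where n = n and m = m, unfolded h_poly_def]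
  show "symmetric_poly (pcompose (P_red (\<Sum>i\<in>{1..<n}. xmon i (i + 1) m)) (beta - 1))"
    using sym by (rule conjunct1)
  show "\<forall>i. coeff (pcompose (P_red (\<Sum>i\<in>{1..<n}. xmon i (i + 1) m)) (beta - 1)) i \<ge> 0"
    using sym by (rule conjunct2)
qed

end
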